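(* Let $f_d$ and $\|\cdot\|$ be any two norms on $\mathbb{R}^N$ and $(\psi_i)_{i\in I}$ be a dictionary in $\mathbb{R}^N$. For any $K\in\{0,\ldots,N\}$, let $\tau>0$ and $\theta$ be such that $\theta\ge\tau\Delta_K$. Consider a random variable $d$ with uniform distribution on $\mathcal{L}_{f_d}(\theta)$. Then $$\frac{\overline{C}_K}{\mathbb{L}^N(\mathcal{L}_{f_d}(1))}\left(\frac{\tau}{\theta}\right)^{N-K}\left(1-\hat\delta_K\frac{\tau}{\theta}\right)^K-\frac{\varepsilon_0(K,\tau,\theta)}{\mathbb{L}^N(\mathcal{L}_{f_d}(1))}\ \le\ \mathbb{P}\left(\mathrm{val}(\mathcal{P}_d)\le K\right)\ \le\ \frac{\overline{C}_K}{\mathbb{L}^N(\mathcal{L}_{f_d}(1))}\left(\frac{\tau}{\theta}\right)^{N-K}\left(1+\hat\delta_K\frac{\tau}{\theta}\right)^K .$$ Moreover, we have the following asymptotic result: $$\mathbb{P}\left(\mathrm{val}(\mathcal{P}_d)\le K\right)=\frac{\overline{C}_K}{\mathbb{L}^N(\mathcal{L}_{f_d}(1))}\left(\frac{\tau}{\theta}\right)^{N-K}+o\left(\left(\frac{\tau}{\theta}\right)^{N-K}\right)\quad\text{as }\frac{\tau}{\theta}\to0.$$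
   Context: $N\ge1$ is an integer; $\|\cdot\|$ and $f_d$ are arbitrary norms on $\mathbb{R}^N$; $\|\cdot\|_2$ is the Euclidean norm; the dictionary $(\psi_i)_{i\in I}$ is a finite family in $\mathbb{R}^N$ with $\mathrm{span}\{\psi_i:i\in I\}=\mathbb{R}^N$. For $d\in\mathbb{R}^N$ and $\tau>0$, $\mathrm{val}(\mathcal{P}_d)$ is the minimum of $\#\{i\in I:\lambda_i\neq0\}$ over all $(\lambda_i)_{i\in I}\in\mathbb{R}^I$ with $\|\sum_{i\in I}\lambda_i\psi_i-d\|\le\tau$. For a function $f$, $\mathcal{L}_f(t)=\{w:f(w)\le t\}$. $P_V$ is the orthogonal projection onto a subspace $V$, $V^\bot$ the orthogonal complement. $\mathbb{L}^k$ is $k$-dimensional Lebesgue measure (on a $k$-dimensional subspace of $\mathbb{R}^N$, via identification with $\mathbb{R}^k$ by an orthonormal basis), with $\mathbb{L}^0(\{0\})=1$; zeroth powers equal $1$. For $J\subset I$: $\mathcal{T}_J=\mathrm{span}((\psi_j)_{j\in J})$ ($\mathrm{span}(\emptyset)=\{0\}$) and $\mathcal{T}_J^\tau=\mathcal{T}_J+P_{\mathcal{T}_J^\bot}(\mathcal{L}_{\|\cdot\|}(\tau))$. Constants. Fix $\delta_1,\delta_2>0$ with $f_d(w)\le\delta_1\|w\|_2$ and $\|w\|_2\le\delta_2\|w\|$ for all $w\in\mathbb{R}^N$, and let $\overline{\Delta}=\delta_1\delta_2$. For $J\subset I$, let $h_J$ be the norm on $\mathcal{T}_J^\bot$ given by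 $h_J(u)=\inf\{t>0:u/t\in P_{\mathcal{T}_J^\bot}(\mathcal{L}_{\|\cdot\|}(1))\}$; $\delta_J\in[0,\overline{\Delta}]$ is a fixed constant with $f_d(u)\le\delta_Jh_J(u)$ for all $u\in\mathcal{T}_J^\bot$; and, with $K=\dim\mathcal{T}_J$, $C_J=\mathbb{L}^{N-K}\big(P_{\mathcal{T}_J^\bot}(\mathcal{L}_{\|\cdot\|}(1))\big)\,\mathbb{L}^K\big(\mathcal{T}_J\cap\mathcal{L}_{f_d}(1)\big)$. $\mathcal{J}(K)$ is a fixed collection of subsets $J\subset I$ with $\dim\mathcal{T}_J=K$, such that distinct members have distinct spans $\mathcal{T}_J$ and every $K$-dimensional subspace of the form $\mathcal{T}_{J_1}$, $J_1\subset I$, equals $\mathcal{T}_J$ for some $J\in\mathcal{J}(K)$; $\mathcal{J}(0)=\{\emptyset\}$. Set $\hat\delta_K=\max_{J\in\mathcal{J}(K)}\delta_J$ and $\overline{C}_K=\sum_{J\in\mathcal{J}(K)}C_J$. Let $k_K=\max\{0,2K-N\}$ and $\mathcal{H}(K,k)=\{(J_1,J_2)\in\mathcal{J}(K)^2:\dim(\mathcal{T}_{J_1}\cap\mathcal{T}_{J_2})=k\}$ for $0\le k\le K-1$. For $(J_1,J_2)\in\mathcal{H}(K,k)$ put $W=\mathcal{T}_{J_1}\cap\mathcal{T}_{J_2}$ and $$Q_{J_1,J_2}=\mathbb{L}^{N-k}\big(W^\bot\cap\mathcal{L}_{\|\cdot\|_2}(2\delta_2)\big)\,\mathbb{L}^k\big(W\cap\mathcal{L}_{f_d}(1)\big),$$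 and let $\delta_{J_1,J_2}\in[0,3\overline{\Delta}]$ be a fixed constant such that for all $\tau,\theta>0$ with $\theta\ge\delta_{J_1,J_2}\tau$, $$\mathbb{L}^N\big(\mathcal{T}_{J_1}^\tau\cap\mathcal{T}_{J_2}^\tau\cap\mathcal{L}_{f_d}(\theta)\big)\le Q_{J_1,J_2}\tau^{N-k}(\theta+\delta_{J_1,J_2}\tau)^k.$$ For $1\le K\le N-1$ and $k_K\le k\le K-1$: $\hat\delta'_{K,k}=\max\{0,\max_{(J_1,J_2)\in\mathcal{H}(K,k)}\delta_{J_1,J_2}\}$ and $\overline{Q}_{K,k}=\sum_{(J_1,J_2)\in\mathcal{H}(K,k)}Q_{J_1,J_2}$ (both are $0$ if $\mathcal{H}(K,k)=\emptyset$). $\Delta_0=\hat\delta_0$; $\Delta_K=\max\{\Delta_{K-1},\hat\delta_K,\max_{k_K\le k\le K-1}\hat\delta'_{K,k}\}$ for $0<K<N$; $\Delta_N=\max\{\Delta_{N-1},\hat\delta_N\}$. $\varepsilon_0(K,\tau,\theta)=0$ if $K=0$ or $K=N$, and $\varepsilon_0(K,\tau,\theta)=\sum_{k=k_K}^{K-1}\overline{Q}_{K,k}\left(\frac{\tau}{\theta}\right)^{N-k}\left(1+\hat\delta'_{K,k}\frac{\tau}{\theta}\right)^k$ if $0<K<N$. In the asymptotic statement, $N$, $K$, the norms and the dictionary are fixed. *)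

theory Defs
  imports
    "HOL-Probability.Probability"
    "HOL-Library.Landau_Symbols"
begin

definition is_norm :: "('a::real_vector \<Rightarrow> real) \<Rightarrow> bool" where
  "is_norm f \<longleftrightarrow>
     (\<forall>x. 0 \<le> f x) \<and> (\<forall>x. f x = 0 \<longleftrightarrow> x = 0) \<and>
     (\<forall>c x. f (c *\<^sub>R x) = \<bar>c\<bar> * f x) \<and> (\<forall>x y. f (x + y) \<le> f x + f y)"

definition level :: "('a \<Rightarrow> real) \<Rightarrow> real \<Rightarrow> 'a set" where
  "level f t = {w. f w \<le> t}"

text \<open>Meaningful when \<open>V\<close> is a linear subspace.\<close>
definition orth_proj :: "'a::euclidean_space set \<Rightarrow> 'a \<Rightarrow> 'a" where
  "orth_proj V x = (THE p. p \<in> V \<and> x - p \<in> V\<^sup>\<bottom>)"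

definition orthonormal_basis_of :: "'a::euclidean_space set \<Rightarrow> 'a set \<Rightarrow> bool" where
  "orthonormal_basis_of V B \<longleftrightarrow>
     finite B \<and> pairwise orthogonal B \<and> (\<forall>b\<in>B. norm b = 1) \<and> span B = V"

text \<open>
  Lebesgue measure of dimension \<open>dim V\<close> on a subspace \<open>V\<close>, as a Borel measure on the
  ambient space concentrated on \<open>V\<close>: the image of the product Lebesgue measure under the
  coordinate map of an orthonormal basis. For \<open>V = {0}\<close> the basis is empty, the product
  measure is the point mass on \<open>\<lambda>_. undefined\<close>, and the image is the point mass at \<open>0\<close>.
\<close>
definition subspace_lborel :: "'a::euclidean_space set \<Rightarrow> 'a measure" where
  "subspace_lborel V =
     (let B = (SOME B. orthonormal_basis_of V B)
      in distr (PiM B (\<lambda>_. lborel :: real measure)) borel (\<lambda>c. \<Sum>b\<in>B. c b *\<^sub>R b))"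

definition uniformly_distributed ::
  "'w measure \<Rightarrow> ('w \<Rightarrow> 'a::euclidean_space) \<Rightarrow> 'a set \<Rightarrow> bool" where
  "uniformly_distributed M X A \<longleftrightarrow>
     prob_space M \<and> X \<in> borel_measurable M \<and> distr M lborel X = uniform_measure lborel A"

text \<open>
  Throughout, \<open>I\<close> and \<open>\<psi>\<close> are the dictionary, \<open>nrm\<close> and \<open>f\<close> stand for the two norms
  (\<open>nrm\<close> measures the data fidelity, \<open>f\<close> the size of the datum), \<open>\<J>\<close> is the fixed choice of
  representatives of the spans, and \<open>\<delta>\<close>, \<open>\<delta>'\<close> are the constants attached to
  index sets and to pairs of index sets.
\<close>

definition val ::
  "'i set \<Rightarrow> ('i \<Rightarrow> 'a::euclidean_space) \<Rightarrow> ('a \<Rightarrow> real) \<Rightarrow> real \<Rightarrow> 'a \<Rightarrow> nat" where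
  "val I \<psi> nrm \<tau> d =
     (LEAST n. \<exists>l :: 'i \<Rightarrow> real. nrm ((\<Sum>i\<in>I. l i *\<^sub>R \<psi> i) - d) \<le> \<tau> \<and>
                 n = card {i \<in> I. l i \<noteq> 0})"

definition T_span :: "('i \<Rightarrow> 'a::euclidean_space) \<Rightarrow> 'i set \<Rightarrow> 'a set" where
  "T_span \<psi> J = span (\<psi> ` J)"

definition T_thick ::
  "('i \<Rightarrow> 'a::euclidean_space) \<Rightarrow> ('a \<Rightarrow> real) \<Rightarrow> real \<Rightarrow> 'i set \<Rightarrow> 'a set" where
  "T_thick \<psi> nrm \<tau> J =
     {x + y | x y. x \<in> T_span \<psi> J \<and> y \<in> orth_proj ((T_span \<psi> J)\<^sup>\<bottom>) ` level nrm \<tau>}"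

definition h_gauge ::
  "('i \<Rightarrow> 'a::euclidean_space) \<Rightarrow> ('a \<Rightarrow> real) \<Rightarrow> 'i set \<Rightarrow> 'a \<Rightarrow> real" where
  "h_gauge \<psi> nrm J u = Inf {t. 0 < t \<and> u /\<^sub>R t \<in> orth_proj ((T_span \<psi> J)\<^sup>\<bottom>) ` level nrm 1}"

definition C_const ::
  "('i \<Rightarrow> 'a::euclidean_space) \<Rightarrow> ('a \<Rightarrow> real) \<Rightarrow> ('a \<Rightarrow> real) \<Rightarrow> 'i set \<Rightarrow> real" where
  "C_const \<psi> nrm f J =
     measure (subspace_lborel ((T_span \<psi> J)\<^sup>\<bottom>)) (orth_proj ((T_span \<psi> J)\<^sup>\<bottom>) ` level nrm 1) *
     measure (subspace_lborel (T_span \<psi> J)) (T_span \<psi> J \<inter> level f 1)"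

definition representatives ::
  "'i set \<Rightarrow> ('i \<Rightarrow> 'a::euclidean_space) \<Rightarrow> nat \<Rightarrow> 'i set set \<Rightarrow> bool" where
  "representatives I \<psi> K \<J>K \<longleftrightarrow>
     (\<forall>J\<in>\<J>K. J \<subseteq> I \<and> dim (T_span \<psi> J) = K) \<and>
     inj_on (T_span \<psi>) \<J>K \<and>
     (\<forall>J1. J1 \<subseteq> I \<and> dim (T_span \<psi> J1) = K \<longrightarrow> (\<exists>J\<in>\<J>K. T_span \<psi> J = T_span \<psi> J1))"

definition delta_hat :: "(nat \<Rightarrow> 'i set set) \<Rightarrow> ('i set \<Rightarrow> real) \<Rightarrow> nat \<Rightarrow> real" where
  "delta_hat \<J> \<delta> K = Max (\<delta> ` \<J> K)"

definition C_bar ::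
  "('i \<Rightarrow> 'a::euclidean_space) \<Rightarrow> ('a \<Rightarrow> real) \<Rightarrow> ('a \<Rightarrow> real) \<Rightarrow>
    (nat \<Rightarrow> 'i set set) \<Rightarrow> nat \<Rightarrow> real" where
  "C_bar \<psi> nrm f \<J> K = (\<Sum>J\<in>\<J> K. C_const \<psi> nrm f J)"

text \<open>Truncated subtraction: this is \<open>max {0, 2 K - N}\<close>.\<close>
definition k_min :: "nat \<Rightarrow> nat \<Rightarrow> nat" where
  "k_min N K = 2 * K - N"

definition H_pairs ::
  "('i \<Rightarrow> 'a::euclidean_space) \<Rightarrow> (nat \<Rightarrow> 'i set set) \<Rightarrow> nat \<Rightarrow> nat \<Rightarrow>
    ('i set \<times> 'i set) set" where
  "H_pairs \<psi> \<J> K k = {(J1, J2). J1 \<in> \<J> K \<and> J2 \<in> \<J> K \<and> dim (T_span \<psi> J1 \<inter> T_span \<psi> J2) = k}"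

text \<open>Here \<open>\<delta>\<^sub>2\<close> is the constant in \<open>norm w \<le> \<delta>\<^sub>2 * nrm w\<close>.\<close>
definition Q_const ::
  "('i \<Rightarrow> 'a::euclidean_space) \<Rightarrow> ('a \<Rightarrow> real) \<Rightarrow> real \<Rightarrow> 'i set \<times> 'i set \<Rightarrow> real" where
  "Q_const \<psi> f \<delta>\<^sub>2 = (\<lambda>(J1, J2). let W = T_span \<psi> J1 \<inter> T_span \<psi> J2 in
     measure (subspace_lborel (W\<^sup>\<bottom>)) (W\<^sup>\<bottom> \<inter> level norm (2 * \<delta>\<^sub>2)) *
     measure (subspace_lborel W) (W \<inter> level f 1))"

definition delta'_hat ::
  "('i \<Rightarrow> 'a::euclidean_space) \<Rightarrow> (nat \<Rightarrow> 'i set set) \<Rightarrow> ('i set \<times> 'i set \<Rightarrow> real) \<Rightarrow>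
    nat \<Rightarrow> nat \<Rightarrow> real" where
  "delta'_hat \<psi> \<J> \<delta>' K k = Max (insert 0 (\<delta>' ` H_pairs \<psi> \<J> K k))"

definition Q_bar ::
  "('i \<Rightarrow> 'a::euclidean_space) \<Rightarrow> ('a \<Rightarrow> real) \<Rightarrow> real \<Rightarrow> (nat \<Rightarrow> 'i set set) \<Rightarrow>
    nat \<Rightarrow> nat \<Rightarrow> real" where
  "Q_bar \<psi> f \<delta>\<^sub>2 \<J> K k = (\<Sum>p\<in>H_pairs \<psi> \<J> K k. Q_const \<psi> f \<delta>\<^sub>2 p)"

primrec Delta ::
  "('i \<Rightarrow> 'a::euclidean_space) \<Rightarrow> (nat \<Rightarrow> 'i set set) \<Rightarrow> ('i set \<Rightarrow> real) \<Rightarrow>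
    ('i set \<times> 'i set \<Rightarrow> real) \<Rightarrow> nat \<Rightarrow> real" where
  "Delta \<psi> \<J> \<delta> \<delta>' 0 = delta_hat \<J> \<delta> 0"
| "Delta \<psi> \<J> \<delta> \<delta>' (Suc K) =
     (if Suc K < DIM('a)
      then Max ({Delta \<psi> \<J> \<delta> \<delta>' K, delta_hat \<J> \<delta> (Suc K)} \<union>
                delta'_hat \<psi> \<J> \<delta>' (Suc K) ` {k_min DIM('a) (Suc K)..Suc K - 1})
      else max (Delta \<psi> \<J> \<delta> \<delta>' K) (delta_hat \<J> \<delta> (Suc K)))"

definition epsilon0 ::
  "('i \<Rightarrow> 'a::euclidean_space) \<Rightarrow> ('a \<Rightarrow> real) \<Rightarrow> real \<Rightarrow> (nat \<Rightarrow> 'i set set) \<Rightarrow>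
    ('i set \<times> 'i set \<Rightarrow> real) \<Rightarrow> nat \<Rightarrow> real \<Rightarrow> real \<Rightarrow> real" where
  "epsilon0 \<psi> f \<delta>\<^sub>2 \<J> \<delta>' K \<tau> \<theta> =
     (if 0 < K \<and> K < DIM('a)
      then (\<Sum>k = k_min DIM('a) K..K - 1.
             Q_bar \<psi> f \<delta>\<^sub>2 \<J> K k * (\<tau> / \<theta>) ^ (DIM('a) - k) *
             (1 + delta'_hat \<psi> \<J> \<delta>' K k * (\<tau> / \<theta>)) ^ k)
      else 0)"

text \<open>The limit \<open>\<tau> / \<theta> \<rightarrow> 0\<close> over pairs \<open>(\<tau>, \<theta>)\<close> with \<open>\<tau>, \<theta> > 0\<close>.\<close>
definition ratio_to_0 :: "(real \<times> real) filter" where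
  "ratio_to_0 =
     inf (filtercomap (\<lambda>(\<tau>, \<theta>). \<tau> / \<theta>) (nhds 0)) (principal ({0<..} \<times> {0<..}))"

end

(*
  A datum d has val <= K exactly when it lies in one of the slabs T_J + B, with J ranging over the
  chosen representatives and B the tau-ball of the fidelity norm. By Fubini along T_J and its
  orthogonal complement, the part of a slab inside the theta-ball of f_d lies between two orthogonal
  products whose measures are C_J * tau^(N-K) * (theta -+ delta_J * tau)^K. The union bound gives the
  upper estimate and Bonferroni's inequality the lower one; two distinct spans of dimension K meet in
  dimension between 2K-N and K-1, so the pairwise overlaps are covered by epsilon0.
*)
theory Submission
  imports Defs
begin

text \<open>\<open>subspace_lborel V\<close> comes from one orthonormal basis picked by
  \<open>SOME\<close>, so its definition does not tie it to \<open>lborel\<close>. The tie is this: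
  the bases picked for V and for its complement unite to an orthonormal basis of the whole space,
  and \<open>lborel\<close> is the product measure in every such basis. The latter is rotation
  invariance, derived from uniqueness of translation-invariant measures. The radii \<theta> -+
  \<delta> * \<tau> come from the triangle inequality: a point of a slab is x + y with y in the
  projected \<tau>-ball, and there f_d(y) is at most \<delta> * \<tau>, because the gauge h_J is at
  most 1 on the projected unit ball. The condition \<theta> \<ge> \<tau> * Delta_K keeps the smaller
  radius nonnegative and also licenses the assumed estimate for each overlap. A datum with val \<le>
  K may use a span of dimension below K, whereas the representatives have dimension exactly K; such
  a span is first enlarged inside the dictionary. In the limit, an overlap of dimension k \<le> K -
  1 carries the power N - k of \<tau> / \<theta>, at least one more than the main term.\<close>

section \<open>Lebesgue measure in orthonormal coordinates\<close>

text \<open>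
  Uniqueness of Haar measure: integrating \<open>1\<^sub>A(x) 1\<^sub>B(x + y)\<close> in both orders, with \<open>A\<close> the unit ball,
  gives \<open>\<mu> A * lborel B = lborel A * \<mu> B\<close>.
\<close>
lemma translation_invariant_eq_lborel:
  fixes \<mu> :: "'a::euclidean_space measure"
  assumes sets [measurable_cong]: "sets \<mu> = sets borel"
    and fin: "sigma_finite_measure \<mu>"
    and inv: "\<And>a. distr \<mu> borel ((+) a) = \<mu>"
    and unit: "emeasure \<mu> (ball 0 1) = emeasure lborel (ball (0::'a) 1)"
  shows "\<mu> = lborel"
proof (rule measure_eqI)
  show "sets \<mu> = sets lborel" by (simp add: sets)
next
  fix B assume "B \<in> sets \<mu>"
  then have B[measurable]: "B \<in> sets borel" by (simp add: sets)
  interpret \<mu>: sigma_finite_measure \<mu> by fact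
  interpret pair_sigma_finite \<mu> lborel
    by (simp add: pair_sigma_finite_def fin sigma_finite_lborel)
  define A where "A = ball (0::'a) 1"
  have A[measurable]: "A \<in> sets borel" by (simp add: A_def)
  define v where "v = emeasure lborel A"
  \<comment> \<open>Both facts are what cancelling \<open>v\<close> in \<open>ennreal\<close>
    requires at the end.\<close>
  have v: "v \<noteq> 0" "v \<noteq> \<infinity>"
    using emeasure_lborel_ball_finite[of 0 1] open_not_negligible[of "ball (0::'a) 1"]
    by (auto simp: v_def A_def negligible_iff_null_sets null_sets_def dest: less_imp_neq)
  have invl: "(\<integral>\<^sup>+y. h (x + y) \<partial>lborel) = (\<integral>\<^sup>+y. h y \<partial>lborel)"
    if [measurable]: "h \<in> borel_measurable borel" for h :: "'a \<Rightarrow> ennreal" and x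
    by (subst (2) lborel_distr_plus[symmetric, of x], subst nn_integral_distr) auto
  have invm: "(\<integral>\<^sup>+y. h (x + y) \<partial>\<mu>) = (\<integral>\<^sup>+y. h y \<partial>\<mu>)"
    if [measurable]: "h \<in> borel_measurable borel" for h :: "'a \<Rightarrow> ennreal" and x
    by (subst (2) inv[symmetric, of x], subst nn_integral_distr) auto
  have "v * emeasure lborel B = (\<integral>\<^sup>+x. indicator A x * (\<integral>\<^sup>+y. indicator B y \<partial>lborel) \<partial>\<mu>)"
  proof -
    have "indicator A \<in> borel_measurable \<mu>" by measurable
    then have "(\<integral>\<^sup>+x. indicator A x * (\<integral>\<^sup>+y. indicator B y \<partial>lborel) \<partial>\<mu>) = emeasure \<mu> A * emeasure lborel B"
      by (subst nn_integral_multc) (simp_all add: sets)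
    then show ?thesis using unit by (simp add: v_def A_def)
  qed
  \<comment> \<open>Invariance of \<open>lborel\<close> inserts the shift by x; after the exchange
    of integrals, invariance of \<mu> moves the shift from B to A.\<close>
  also have "\<dots> = (\<integral>\<^sup>+x. (\<integral>\<^sup>+y. indicator A x * indicator B (x + y) \<partial>lborel) \<partial>\<mu>)"
    by (subst nn_integral_cmult) (auto simp: invl[of "indicator B"] simp del: nn_integral_indicator)
  also have "\<dots> = (\<integral>\<^sup>+y. (\<integral>\<^sup>+x. indicator A x * indicator B (x + y) \<partial>\<mu>) \<partial>lborel)"
    by (rule Fubini'[symmetric]) measurable
  also have "\<dots> = (\<integral>\<^sup>+y. (\<integral>\<^sup>+x. indicator A (x - y) * indicator B x \<partial>\<mu>) \<partial>lborel)"
  proof (rule nn_integral_cong)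
    fix y :: 'a
    show "(\<integral>\<^sup>+x. indicator A x * indicator B (x + y) \<partial>\<mu>)
      = (\<integral>\<^sup>+x. indicator A (x - y) * indicator B x \<partial>\<mu>)"
      using invm[of "\<lambda>x. indicator A (x - y) * indicator B x" y] by (simp add: add.commute)
  qed
  also have "\<dots> = (\<integral>\<^sup>+x. (\<integral>\<^sup>+y. indicator A (x - y) * indicator B x \<partial>lborel) \<partial>\<mu>)"
    by (rule Fubini') measurable
  also have "\<dots> = (\<integral>\<^sup>+x. v * indicator B x \<partial>\<mu>)"
  proof (rule nn_integral_cong)
    fix x :: 'a
    \<comment> \<open>The ball is symmetric about 0, which turns the reflection in y into a
      translation.\<close>
    have "(\<integral>\<^sup>+y. indicator A (x - y) \<partial>lborel) = (\<integral>\<^sup>+y. indicator A (- x + y) \<partial>lborel)"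
      by (intro nn_integral_cong) (auto simp: A_def indicator_def dist_norm norm_minus_commute)
    also have "\<dots> = v"
      by (subst invl) (auto simp: v_def)
    finally show "(\<integral>\<^sup>+y. indicator A (x - y) * indicator B x \<partial>lborel) = v * indicator B x"
      by (subst nn_integral_multc) auto
  qed
  also have "\<dots> = v * emeasure \<mu> B"
    by (subst nn_integral_cmult) (auto simp: sets)
  finally show "emeasure \<mu> B = emeasure lborel B"
    using v by (metis ennreal_mult_cancel_left infinity_ennreal_def)
qed

text \<open>The image measure is again translation invariant, since a shift by a after T is T after
  a shift by \<open>inv T a\<close>, and T maps the unit ball onto itself; so the uniqueness lemma
  applies. Sigma-finiteness follows because the image under \<open>inv T\<close> is
  \<open>lborel\<close> again.\<close>

lemma distr_lborel_orthogonal_transformation: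
  fixes T :: "'a::euclidean_space \<Rightarrow> 'a"
  assumes T: "orthogonal_transformation T"
  shows "distr lborel borel T = lborel"
proof (rule translation_invariant_eq_lborel)
  have lin: "linear T" using T by (rule orthogonal_transformation_linear)
  have "continuous_on UNIV T" by (rule linear_continuous_on[OF linear_conv_bounded_linear[THEN iffD1, OF lin]])
  then have [measurable]: "T \<in> borel_measurable borel"
    by (rule borel_measurable_continuous_onI)
  have bij: "bij T" using T by (rule orthogonal_transformation_bij)
  have Ti: "orthogonal_transformation (inv T)" using T by (rule orthogonal_transformation_inv)
  then have lini: "linear (inv T)" by (rule orthogonal_transformation_linear)
  have "continuous_on UNIV (inv T)" by (rule linear_continuous_on[OF linear_conv_bounded_linear[THEN iffD1, OF lini]])
  then have [measurable]: "inv T \<in> borel_measurable borel"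
    by (rule borel_measurable_continuous_onI)
  show "sigma_finite_measure (distr lborel borel T)"
  proof (rule sigma_finite_measure_distr)
    have "distr (distr lborel borel T) borel (inv T) = distr lborel borel (\<lambda>x. x)"
      using bij by (simp add: distr_distr comp_def bij_is_inj cong: distr_cong)
    also have "\<dots> = lborel" by (rule distr_id2) simp
    finally show "sigma_finite_measure (distr (distr lborel borel T) borel (inv T))"
      by (simp add: sigma_finite_lborel)
  qed simp
  show "distr (distr lborel borel T) borel ((+) a) = distr lborel borel T" for a
  proof -
    have "(+) a \<circ> T = T \<circ> (+) (inv T a)"
      using bij lin by (auto simp: linear_add fun_eq_iff bij_is_surj surj_f_inv_f)
    then have "distr (distr lborel borel T) borel ((+) a) = distr (distr lborel borel ((+) (inv T a))) borel T"
      by (simp add: distr_distr)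
    then show ?thesis by (simp add: lborel_distr_plus)
  qed
  have "T -` ball 0 1 = ball 0 1"
    using T by (auto simp: orthogonal_transformation_norm)
  then show "emeasure (distr lborel borel T) (ball 0 1) = emeasure lborel (ball (0::'a) 1)"
    by (simp add: emeasure_distr)
qed simp

section \<open>Product Lebesgue measure and coordinates in orthonormal bases\<close>

text \<open>Boxes determine the product measure, and the preimage of a box is a box with rescaled,
  relabelled sides. Two instances serve later: t = 1 changes the index set from \<open>Basis\<close>
  to another basis, and the identity for \<open>g\<close> gives the scaling law on a
  subspace.\<close>

lemma distr_PiM_lborel_scale_reindex:
  fixes t :: real and g :: "'a \<Rightarrow> 'b"
  assumes g: "bij_betw g B' B" and fin: "finite B'" and t: "t \<noteq> 0"
  shows "scale_measure (\<bar>t\<bar> ^ card B')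
    (distr (PiM B (\<lambda>_. lborel)) (PiM B' (\<lambda>_. lborel)) (\<lambda>c. \<lambda>b\<in>B'. t * c (g b)))
    = (PiM B' (\<lambda>_. lborel))" (is "?P = _")
proof -
  interpret product_sigma_finite "\<lambda>_. lborel :: real measure" ..
  have finB: "finite B" using g fin bij_betw_finite by blast
  have gB: "g b \<in> B" if "b \<in> B'" for b using g that by (auto simp: bij_betw_def)
  show ?thesis
  proof (rule PiM_eqI)
    fix A :: "'a \<Rightarrow> real set" assume A: "\<And>i. i \<in> B' \<Longrightarrow> A i \<in> sets lborel"
    let ?g = "the_inv_into B' g"
    have g': "?g (g b) = b" if "b \<in> B'" for b
      using g that by (simp add: bij_betw_def the_inv_into_f_f)
    have g'B: "?g b \<in> B'" "g (?g b) = b" if "b \<in> B" for b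
      using g that by (auto simp: bij_betw_def the_inv_into_into f_the_inv_into_f)
    have meas: "(\<lambda>c. \<lambda>b\<in>B'. t * c (g b)) \<in> measurable (PiM B (\<lambda>_. lborel)) (PiM B' (\<lambda>_. lborel))"
      using gB by measurable
    have vim: "(*) t -` A (?g b) \<in> sets lborel" if "b \<in> B" for b
    proof -
      have "(*) t -` A (?g b) \<inter> space lborel \<in> sets lborel"
        by (rule measurable_sets[OF _ A]) (use g'B that in auto)
      then show ?thesis by simp
    qed
    have pre: "(\<lambda>c. \<lambda>b\<in>B'. t * c (g b)) -` Pi\<^sub>E B' A \<inter> space (PiM B (\<lambda>_. lborel :: real measure))
      = (\<Pi>\<^sub>E b\<in>B. (*) t -` A (?g b))"
      using gB g' g'B
      by (auto simp: space_PiM PiE_iff Pi_iff extensional_def) (metis+)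
    have sc: "ennreal \<bar>t\<bar> * emeasure lborel ((*) t -` X) = emeasure lborel X" if X: "X \<in> sets borel" for X
    proof -
      have "emeasure lborel X = emeasure (density (distr lborel borel ((*) t)) (\<lambda>_. \<bar>t\<bar>)) X"
        using lborel_distr_mult'[OF t] by simp
      also have "\<dots> = ennreal \<bar>t\<bar> * emeasure lborel ((*) t -` X)"
        using X by (simp add: emeasure_density nn_integral_cmult emeasure_distr)
      finally show ?thesis by simp
    qed
    have card: "card B' = card B" using g by (rule bij_betw_same_card)
    have "emeasure ?P (Pi\<^sub>E B' A) = \<bar>t\<bar> ^ card B * (\<Prod>b\<in>B. emeasure lborel ((*) t -` A (?g b)))"
      using A fin finB vim meas
      by (simp add: emeasure_distr pre emeasure_PiM card)
    also have "ennreal (\<bar>t\<bar> ^ card B) * (\<Prod>b\<in>B. emeasure lborel ((*) t -` A (?g b)))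
      = (\<Prod>b\<in>B. ennreal \<bar>t\<bar> * emeasure lborel ((*) t -` A (?g b)))"
      by (simp add: prod.distrib ennreal_power)
    also have "\<dots> = (\<Prod>b\<in>B. emeasure lborel (A (?g b)))"
      using A g'B by (intro prod.cong) (auto simp: sc)
    also have "\<dots> = (\<Prod>b\<in>B'. emeasure lborel (A b))"
      using prod.reindex_bij_betw[OF g, of "\<lambda>b. emeasure lborel (A (?g b))"] g' by simp
    finally show "emeasure ?P (Pi\<^sub>E B' A) = (\<Prod>b\<in>B'. emeasure lborel (A b))" .
  qed (use fin in auto)
qed

lemma orthonormal_basis_of_exists:
  assumes "subspace V"
  shows "\<exists>B. orthonormal_basis_of V B"
proof -
  obtain B where "pairwise orthogonal B" "\<And>x. x \<in> B \<Longrightarrow> norm x = 1" "independent B" "span B = V"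
    using orthonormal_basis_subspace[OF assms] by metis
  then show ?thesis
    using independent_imp_finite by (auto simp: orthonormal_basis_of_def)
qed

lemma orthonormal_basis_of_card:
  assumes "orthonormal_basis_of V B"
  shows "card B = dim V"
proof -
  have "0 \<notin> B" using assms by (auto simp: orthonormal_basis_of_def)
  then have "independent B"
    using assms by (intro pairwise_orthogonal_independent) (auto simp: orthonormal_basis_of_def)
  then show ?thesis
    using assms dim_span_eq_card_independent[of B] by (simp add: orthonormal_basis_of_def)
qed

lemma orthonormal_basis_of_sum_mem:
  assumes "orthonormal_basis_of V B"
  shows "(\<Sum>b\<in>B. c b *\<^sub>R b) \<in> V"
proof -
  have "(\<Sum>b\<in>B. c b *\<^sub>R b) \<in> span B"
    by (intro span_sum span_scale span_base)
  then show ?thesis using assms by (simp add: orthonormal_basis_of_def)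
qed

lemma subspace_lborel_basis:
  assumes "subspace V"
  obtains B where "orthonormal_basis_of V B"
    "subspace_lborel V = distr (PiM B (\<lambda>_. lborel)) borel (\<lambda>c. \<Sum>b\<in>B. c b *\<^sub>R b)"
  using that someI_ex[OF orthonormal_basis_of_exists[OF assms]]
  by (simp add: subspace_lborel_def Let_def)

lemma norm_sum_orthonormal:
  assumes "finite B" "inj_on h B" "pairwise orthogonal (h ` B)" "\<And>b. b \<in> B \<Longrightarrow> norm (h b) = 1"
  shows "(norm (\<Sum>b\<in>B. c b *\<^sub>R h b))\<^sup>2 = (\<Sum>b\<in>B. (c b)\<^sup>2)"
proof -
  have "(norm (\<Sum>b\<in>B. c b *\<^sub>R h b))\<^sup>2 = (\<Sum>b\<in>B. (norm (c b *\<^sub>R h b))\<^sup>2)"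
    using assms
    by (intro norm_sum_Pythagorean)
       (auto simp: pairwise_def orthogonal_def inj_on_def)
  also have "\<dots> = (\<Sum>b\<in>B. (c b)\<^sup>2)"
    using assms by (intro sum.cong) auto
  finally show ?thesis .
qed

text \<open>For the standard basis this is the known description of \<open>lborel\<close>; passing
  to another basis is a rotation, under which \<open>lborel\<close> is invariant.\<close>

lemma lborel_eq_orthonormal_basis:
  fixes B :: "'a::euclidean_space set"
  assumes B: "orthonormal_basis_of UNIV B"
  shows "distr (PiM B (\<lambda>_. lborel)) borel (\<lambda>c. \<Sum>b\<in>B. c b *\<^sub>R b) = (lborel :: 'a measure)"
proof -
  have fin: "finite B" and orth: "pairwise orthogonal B" and one: "\<And>b. b \<in> B \<Longrightarrow> norm b = 1"
    using B by (auto simp: orthonormal_basis_of_def)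
  have "card B = card (Basis :: 'a set)"
    using orthonormal_basis_of_card[OF B] by simp
  then obtain g where g: "bij_betw g B (Basis :: 'a set)"
    using finite_same_card_bij[OF fin finite_Basis] by blast
  have gB: "g b \<in> Basis" if "b \<in> B" for b using g that by (auto simp: bij_betw_def)
  \<comment> \<open>The rotation that sends the standard basis vector \<open>g b\<close> to
    \<open>b\<close>.\<close>
  define T where "T x = (\<Sum>b\<in>B. (x \<bullet> g b) *\<^sub>R b)" for x
  have "linear T"
    by (auto simp: T_def inner_add_left scaleR_add_left sum.distrib scaleR_sum_right intro!: linearI)
  moreover have "norm (T x) = norm x" for x
  proof -
    have "(norm (T x))\<^sup>2 = (\<Sum>b\<in>B. (x \<bullet> g b)\<^sup>2)"
      unfolding T_def using norm_sum_orthonormal[of B "\<lambda>b. b"] fin orth one by auto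
    also have "\<dots> = (\<Sum>e\<in>Basis. (x \<bullet> e)\<^sup>2)"
      by (rule sum.reindex_bij_betw[OF g])
    also have "\<dots> = (norm x)\<^sup>2"
      unfolding power2_norm_eq_inner euclidean_inner[of x x] by (simp add: power2_eq_square)
    finally show ?thesis by simp
  qed
  ultimately have T: "orthogonal_transformation T" by (simp add: orthogonal_transformation)
  have [measurable]: "T \<in> borel_measurable borel" unfolding T_def by measurable
  have meas: "(\<lambda>c. \<lambda>b\<in>B. 1 * c (g b)) \<in> measurable (PiM Basis (\<lambda>_. lborel :: real measure)) (PiM B (\<lambda>_. lborel))"
    using gB by (intro measurable_restrict) simp
  have "PiM B (\<lambda>_. lborel :: real measure) = distr (PiM Basis (\<lambda>_. lborel)) (PiM B (\<lambda>_. lborel)) (\<lambda>c. \<lambda>b\<in>B. 1 * c (g b))"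
    by (rule distr_PiM_lborel_scale_reindex[OF g fin, of 1, symmetric,
      unfolded abs_one power_one ennreal_1 scale_measure_1]) simp
  then have "distr (PiM B (\<lambda>_. lborel)) borel (\<lambda>c. \<Sum>b\<in>B. c b *\<^sub>R b)
    = distr (distr (PiM Basis (\<lambda>_. lborel)) (PiM B (\<lambda>_. lborel)) (\<lambda>c. \<lambda>b\<in>B. 1 * c (g b))) borel (\<lambda>c. \<Sum>b\<in>B. c b *\<^sub>R b)"
    by (rule arg_cong)
  also have "\<dots> = distr (PiM Basis (\<lambda>_. lborel)) borel (\<lambda>c. \<Sum>b\<in>B. c (g b) *\<^sub>R b)"
    by (subst distr_distr[OF _ meas]) (auto simp: comp_def intro!: distr_cong)
  also have "\<dots> = distr (distr (PiM Basis (\<lambda>_. lborel)) borel (\<lambda>c. \<Sum>b\<in>Basis. c b *\<^sub>R b)) borel T"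
  proof -
    have "T (\<Sum>e\<in>Basis. c e *\<^sub>R e) = (\<Sum>b\<in>B. c (g b) *\<^sub>R b)" for c
      using gB by (simp add: T_def inner_sum_left_Basis)
    then show ?thesis by (subst distr_distr) (simp_all add: comp_def)
  qed
  also have "\<dots> = distr lborel borel T" unfolding lborel_eq[where 'a='a, symmetric] ..
  also have "\<dots> = lborel" by (rule distr_lborel_orthogonal_transformation[OF T])
  finally show ?thesis .
qed

lemma orthonormal_basis_of_Un:
  assumes V: "subspace V" and B1: "orthonormal_basis_of V B1" and B2: "orthonormal_basis_of (V\<^sup>\<bottom>) B2"
  shows "B1 \<inter> B2 = {}" "orthonormal_basis_of UNIV (B1 \<union> B2)"
proof -
  have span: "span B1 = V" "span B2 = V\<^sup>\<bottom>"
    using B1 B2 by (simp_all add: orthonormal_basis_of_def)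
  have sub: "B1 \<subseteq> V" "B2 \<subseteq> V\<^sup>\<bottom>"
    using span_superset[of B1] span_superset[of B2] unfolding span by simp_all
  have orth: "orthogonal x y" if "x \<in> B1" "y \<in> B2" for x y
    using that sub unfolding orthogonal_comp_def by blast
  show "B1 \<inter> B2 = {}"
  proof (rule ccontr)
    assume "B1 \<inter> B2 \<noteq> {}"
    then obtain b where "b \<in> B1" "b \<in> B2" by blast
    then have "b = 0" using orth[of b b] by (simp add: orthogonal_self)
    moreover have "norm b = 1" using B1 \<open>b \<in> B1\<close> unfolding orthonormal_basis_of_def by blast
    ultimately show False by simp
  qed
  have "V + V\<^sup>\<bottom> \<subseteq> span (B1 \<union> B2)"
  proof
    fix z assume "z \<in> V + V\<^sup>\<bottom>"
    then obtain x y where "z = x + y" "x \<in> span B1" "y \<in> span B2"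
      unfolding span by (rule set_plus_elim)
    then show "z \<in> span (B1 \<union> B2)"
      by (meson span_add span_mono subsetD sup_ge1 sup_ge2)
  qed
  then have "span (B1 \<union> B2) = UNIV"
    using subspace_sum_orthogonal_comp[OF V] by blast
  moreover have "pairwise orthogonal (B1 \<union> B2)"
    unfolding pairwise_def
  proof (intro ballI impI)
    fix x y assume "x \<in> B1 \<union> B2" "y \<in> B1 \<union> B2" "x \<noteq> y"
    moreover have "pairwise orthogonal B1" "pairwise orthogonal B2"
      using B1 B2 by (simp_all add: orthonormal_basis_of_def)
    ultimately show "orthogonal x y"
      using orth[of x y] orth[of y x, THEN orthogonal_commute[THEN iffD1]] by (metis UnE pairwiseD)
  qed
  ultimately show "orthonormal_basis_of UNIV (B1 \<union> B2)"
    using B1 B2 unfolding orthonormal_basis_of_def by blast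
qed

lemma orth_decomp_unique:
  fixes V :: "'a::euclidean_space set"
  assumes V: "subspace V" and "x \<in> V" "x' \<in> V" "y \<in> V\<^sup>\<bottom>" "y' \<in> V\<^sup>\<bottom>" "x + y = x' + y'"
  shows "x = x' \<and> y = y'"
proof (rule orthogonal_subspace_decomp_unique[where S=V and T="V\<^sup>\<bottom>"])
  show "x + y = x' + y'" by fact
  show "x \<in> span V" "x' \<in> span V" "y \<in> span (V\<^sup>\<bottom>)" "y' \<in> span (V\<^sup>\<bottom>)"
    using assms by (simp_all add: span_base)
  show "orthogonal a b" if "a \<in> V" "b \<in> V\<^sup>\<bottom>" for a b
    using that unfolding orthogonal_comp_def by simp
qed

text \<open>In the united basis the coordinates split into two independent blocks, and the sum set
  becomes a rectangle of preimages. Compactness of both sets makes the sum set Borel.\<close>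

lemma emeasure_lborel_orthogonal_sum:
  fixes V :: "'a::euclidean_space set"
  assumes V: "subspace V" and A: "compact A" "A \<subseteq> V" and C: "compact C" "C \<subseteq> V\<^sup>\<bottom>"
  shows "emeasure lborel {x + y | x y. x \<in> A \<and> y \<in> C}
    = emeasure (subspace_lborel V) A * emeasure (subspace_lborel (V\<^sup>\<bottom>)) C"
proof -
  let ?l = "\<lambda>_. lborel :: real measure"
  define S where "S = {x + y | x y. x \<in> A \<and> y \<in> C}"
  obtain B1 where B1: "orthonormal_basis_of V B1"
    and eq1: "subspace_lborel V = distr (PiM B1 ?l) borel (\<lambda>c. \<Sum>b\<in>B1. c b *\<^sub>R b)"
    using subspace_lborel_basis[OF V] by blast
  obtain B2 where B2: "orthonormal_basis_of (V\<^sup>\<bottom>) B2"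
    and eq2: "subspace_lborel (V\<^sup>\<bottom>) = distr (PiM B2 ?l) borel (\<lambda>c. \<Sum>b\<in>B2. c b *\<^sub>R b)"
    using subspace_lborel_basis[OF subspace_orthogonal_comp] by blast
  note B = orthonormal_basis_of_Un[OF V B1 B2]
  have fin: "finite B1" "finite B2" using B1 B2 by (auto simp: orthonormal_basis_of_def)
  interpret product_sigma_finite ?l ..
  interpret B2: sigma_finite_measure "PiM B2 ?l"
    using fin(2) by (rule sigma_finite)
  have S[measurable]: "S \<in> sets borel"
    using compact_sums[OF A(1) C(1)] by (simp add: borel_compact S_def)
  have [measurable]: "A \<in> sets borel" "C \<in> sets borel" using A C by (auto intro: borel_compact)
  have in1: "(\<Sum>b\<in>B1. c b *\<^sub>R b) \<in> V" for c
    using B1 by (rule orthonormal_basis_of_sum_mem)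
  have in2: "(\<Sum>b\<in>B2. c b *\<^sub>R b) \<in> V\<^sup>\<bottom>" for c
    using B2 by (rule orthonormal_basis_of_sum_mem)
  \<comment> \<open>Uniqueness of the orthogonal decomposition is what makes the preimage of
    \<open>S\<close> a rectangle.\<close>
  have iff: "u + w \<in> S \<longleftrightarrow> u \<in> A \<and> w \<in> C" if "u \<in> V" "w \<in> V\<^sup>\<bottom>" for u w
    using orth_decomp_unique[OF V that(1) _ that(2)] A C unfolding S_def by blast
  have split: "(\<Sum>b\<in>B1 \<union> B2. merge B1 B2 p b *\<^sub>R b)
      = (\<Sum>b\<in>B1. fst p b *\<^sub>R b) + (\<Sum>b\<in>B2. snd p b *\<^sub>R b)" for p
    using fin B(1) by (subst sum.union_disjoint) (auto simp: merge_def split: prod.split intro!: arg_cong2[where f="(+)"] sum.cong)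
  have "(lborel :: 'a measure) = distr (PiM (B1 \<union> B2) ?l) borel (\<lambda>c. \<Sum>b\<in>B1 \<union> B2. c b *\<^sub>R b)"
    by (rule lborel_eq_orthonormal_basis[OF B(2), symmetric])
  also have "\<dots> = distr (PiM B1 ?l \<Otimes>\<^sub>M PiM B2 ?l) borel
      (\<lambda>p. (\<Sum>b\<in>B1. fst p b *\<^sub>R b) + (\<Sum>b\<in>B2. snd p b *\<^sub>R b))"
    by (subst distr_merge[OF B(1) fin, symmetric], subst distr_distr) (simp_all add: comp_def split)
  finally have lb: "(lborel :: 'a measure) = \<dots>" .
  have "emeasure lborel S = emeasure (PiM B1 ?l \<Otimes>\<^sub>M PiM B2 ?l)
      ((\<lambda>p. (\<Sum>b\<in>B1. fst p b *\<^sub>R b) + (\<Sum>b\<in>B2. snd p b *\<^sub>R b)) -` S \<inter> space (PiM B1 ?l \<Otimes>\<^sub>M PiM B2 ?l))"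
    by (subst lb, rule emeasure_distr) measurable
  also have "(\<lambda>p. (\<Sum>b\<in>B1. fst p b *\<^sub>R b) + (\<Sum>b\<in>B2. snd p b *\<^sub>R b)) -` S \<inter> space (PiM B1 ?l \<Otimes>\<^sub>M PiM B2 ?l)
      = ((\<lambda>c. \<Sum>b\<in>B1. c b *\<^sub>R b) -` A \<inter> space (PiM B1 ?l)) \<times> ((\<lambda>c. \<Sum>b\<in>B2. c b *\<^sub>R b) -` C \<inter> space (PiM B2 ?l))"
    using iff[OF in1 in2] by (auto simp: space_pair_measure)
  also have "emeasure (PiM B1 ?l \<Otimes>\<^sub>M PiM B2 ?l) \<dots> = emeasure (subspace_lborel V) A * emeasure (subspace_lborel (V\<^sup>\<bottom>)) C"
    by (subst B2.emeasure_pair_measure_Times) (auto simp: eq1 eq2 emeasure_distr)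
  finally show ?thesis unfolding S_def .
qed

text \<open>Both sides are computed in the same chosen basis, so this is the scaling of each of its
  \<open>dim V\<close> coordinates.\<close>

lemma emeasure_subspace_lborel_scale:
  fixes V :: "'a::euclidean_space set"
  assumes V: "subspace V" and A: "A \<in> sets borel" and t: "0 < t"
  shows "emeasure (subspace_lborel V) ((*\<^sub>R) t ` A) = ennreal (t ^ dim V) * emeasure (subspace_lborel V) A"
proof -
  let ?l = "\<lambda>_. lborel :: real measure"
  obtain B where B: "orthonormal_basis_of V B"
    and eq: "subspace_lborel V = distr (PiM B ?l) borel (\<lambda>c. \<Sum>b\<in>B. c b *\<^sub>R b)"
    using subspace_lborel_basis[OF V] by blast
  have fin: "finite B" and card: "card B = dim V"
    using B orthonormal_basis_of_card[OF B] by (auto simp: orthonormal_basis_of_def)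
  \<comment> \<open>Written as a preimage under a continuous map, the scaled set is visibly
    Borel.\<close>
  have vim: "(*\<^sub>R) t ` A = (*\<^sub>R) (1/t) -` A"
  proof safe
    fix x assume "(1 / t) *\<^sub>R x \<in> A"
    then show "x \<in> (*\<^sub>R) t ` A" using t by (intro image_eqI[of _ _ "(1/t) *\<^sub>R x"]) auto
  qed (use t in auto)
  have tA[measurable]: "(*\<^sub>R) t ` A \<in> sets borel"
    unfolding vim using measurable_sets[OF _ A, of "(*\<^sub>R) (1/t)" borel]
    by (simp add: borel_measurable_const_scaleR)
  let ?r = "\<lambda>c. \<lambda>b\<in>B. t * c b"
  let ?s = "\<lambda>c. \<Sum>b\<in>B. c b *\<^sub>R b"
  have [measurable]: "?r \<in> measurable (PiM B ?l) (PiM B ?l)" by measurable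
  have at: "\<bar>t\<bar> = t" using t by simp
  have "PiM B ?l = scale_measure (ennreal (t ^ dim V)) (distr (PiM B ?l) (PiM B ?l) ?r)"
    by (rule distr_PiM_lborel_scale_reindex[of "\<lambda>b. b" B B t, symmetric, unfolded card at])
       (use t fin in \<open>simp_all add: bij_betw_def\<close>)
  then have "emeasure (PiM B ?l) (?s -` (*\<^sub>R) t ` A \<inter> space (PiM B ?l))
      = ennreal (t ^ dim V) * emeasure (distr (PiM B ?l) (PiM B ?l) ?r) (?s -` (*\<^sub>R) t ` A \<inter> space (PiM B ?l))"
    unfolding emeasure_scale_measure[symmetric] by (rule arg_cong)
  also have "emeasure (distr (PiM B ?l) (PiM B ?l) ?r) (?s -` (*\<^sub>R) t ` A \<inter> space (PiM B ?l))
     = emeasure (PiM B ?l) (?r -` (?s -` (*\<^sub>R) t ` A \<inter> space (PiM B ?l)) \<inter> space (PiM B ?l))"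
    using tA by (intro emeasure_distr) measurable
  also have "?r -` (?s -` (*\<^sub>R) t ` A \<inter> space (PiM B ?l)) \<inter> space (PiM B ?l) = ?s -` A \<inter> space (PiM B ?l)"
  proof -
    have "?s (?r c) = t *\<^sub>R ?s c" for c
      by (simp add: scaleR_sum_right)
    moreover have "t *\<^sub>R u \<in> (*\<^sub>R) t ` A \<longleftrightarrow> u \<in> A" for u
      using t by auto
    ultimately show ?thesis
      by (auto simp: space_PiM)
  qed
  finally show ?thesis
    using A tA by (simp add: eq emeasure_distr)
qed

section \<open>Norm balls and slabs around subspaces\<close>

lemma is_normD:
  assumes "is_norm f"
  shows "0 \<le> f x" "f x = 0 \<longleftrightarrow> x = 0" "f (c *\<^sub>R x) = \<bar>c\<bar> * f x" "f (x + y) \<le> f x + f y"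
  using assms by (auto simp: is_norm_def)

lemma is_norm_minus: "is_norm f \<Longrightarrow> f (- x) = f x"
  using is_normD(3)[of f "-1" x] by simp

lemma is_norm_sum_le:
  assumes "is_norm f"
  shows "f (\<Sum>a\<in>A. g a) \<le> (\<Sum>a\<in>A. f (g a))"
proof (induction A rule: infinite_finite_induct)
  case (insert x F)
  then show ?case using is_normD(4)[OF assms, of "g x" "sum g F"] by simp
qed (use is_normD(2)[OF assms, of 0] in auto)

lemma is_norm_le_norm:
  fixes f :: "'a::euclidean_space \<Rightarrow> real"
  assumes f: "is_norm f"
  shows "f x \<le> (\<Sum>b\<in>Basis. f b) * norm x"
proof -
  have "f x = f (\<Sum>b\<in>Basis. (x \<bullet> b) *\<^sub>R b)" by (simp add: euclidean_representation)
  also have "\<dots> \<le> (\<Sum>b\<in>Basis. f ((x \<bullet> b) *\<^sub>R b))" by (rule is_norm_sum_le[OF f])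
  also have "\<dots> = (\<Sum>b\<in>Basis. \<bar>x \<bullet> b\<bar> * f b)" by (simp add: is_normD(3)[OF f])
  also have "\<dots> \<le> (\<Sum>b\<in>Basis. norm x * f b)"
    by (intro sum_mono mult_right_mono Basis_le_norm is_normD(1)[OF f])
  also have "\<dots> = (\<Sum>b\<in>Basis. f b) * norm x" by (simp add: sum_distrib_left mult.commute)
  finally show ?thesis .
qed

lemma is_norm_continuous_on:
  fixes f :: "'a::euclidean_space \<Rightarrow> real"
  assumes f: "is_norm f"
  shows "continuous_on S f"
proof -
  define C where "C = (\<Sum>b\<in>Basis. f (b::'a))"
  have "C \<ge> 0" by (auto simp: C_def intro!: sum_nonneg is_normD(1)[OF f])
  have *: "f x - f y \<le> C * dist x y" for x y
    using is_normD(4)[OF f, of "x - y" y] is_norm_le_norm[OF f, of "x - y"]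
    by (simp add: C_def dist_norm)
  have "C-lipschitz_on S f"
  proof (rule lipschitz_onI)
    show "dist (f x) (f y) \<le> C * dist x y" for x y
      using *[of x y] *[of y x] by (simp add: dist_real_def dist_commute abs_le_iff)
  qed fact
  then show ?thesis by (rule lipschitz_on_continuous_on)
qed

lemma compact_level:
  fixes f :: "'a::euclidean_space \<Rightarrow> real"
  assumes f: "is_norm f"
  shows "compact (level f t)"
proof -
  have closed: "closed (level f t)"
    unfolding level_def by (intro closed_Collect_le is_norm_continuous_on[OF f] continuous_on_const)
  \<comment> \<open>Equivalence of norms: the minimum of \<open>f\<close> on the Euclidean sphere is
    positive and bounds \<open>level f t\<close>.\<close>
  have "compact (sphere (0::'a) 1)" "sphere (0::'a) 1 \<noteq> {}" by auto
  then obtain x where x: "x \<in> sphere 0 1" "\<And>y. y \<in> sphere 0 1 \<Longrightarrow> f x \<le> f y"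
    using continuous_attains_inf[OF _ _ is_norm_continuous_on[OF f]] by metis
  have "f x \<noteq> 0" using x(1) is_normD(2)[OF f, of x] by auto
  then have pos: "f x > 0" using is_normD(1)[OF f, of x] by simp
  have "norm w * f x \<le> f w" for w
  proof (cases "w = 0")
    case False
    have "f x \<le> f ((1 / norm w) *\<^sub>R w)" using False by (intro x(2)) simp
    also have "\<dots> = f w / norm w" by (simp add: is_normD(3)[OF f])
    finally show ?thesis using False by (simp add: field_simps)
  qed (simp add: is_normD(1)[OF f])
  then have "norm w \<le> t / f x" if "w \<in> level f t" for w
    using that pos by (metis (mono_tags, lifting) level_def mem_Collect_eq order_trans pos_le_divide_eq)
  then have "bounded (level f t)" by (intro boundedI)
  with closed show ?thesis by (simp add: compact_eq_bounded_closed)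
qed

lemma level_scale:
  assumes f: "is_norm f" and t: "t > 0"
  shows "level f (t * s) = (*\<^sub>R) t ` level f s"
proof (intro set_eqI iffI)
  fix x assume "x \<in> level f (t * s)"
  then have "f ((1 / t) *\<^sub>R x) \<le> s"
    using t by (simp add: is_normD(3)[OF f] level_def field_simps)
  then show "x \<in> (*\<^sub>R) t ` level f s"
    using t by (intro image_eqI[of _ _ "(1 / t) *\<^sub>R x"]) (auto simp: level_def)
qed (use t in \<open>auto simp: level_def is_normD(3)[OF f]\<close>)

section \<open>Orthogonal projections and slabs\<close>

lemma orth_proj:
  fixes V :: "'a::euclidean_space set"
  assumes V: "subspace V"
  shows "orth_proj V x \<in> V" "x - orth_proj V x \<in> V\<^sup>\<bottom>"
proof -
  have "x \<in> V + V\<^sup>\<bottom>" using subspace_sum_orthogonal_comp[OF V] by blast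
  then obtain p q where pq: "x = p + q" "p \<in> V" "q \<in> V\<^sup>\<bottom>" by (rule set_plus_elim)
  then have p: "p \<in> V \<and> x - p \<in> V\<^sup>\<bottom>" by simp
  have "orth_proj V x \<in> V \<and> x - orth_proj V x \<in> V\<^sup>\<bottom>"
    unfolding orth_proj_def
  proof (rule theI[of _ p])
    show "p' = p" if "p' \<in> V \<and> x - p' \<in> V\<^sup>\<bottom>" for p'
      by (rule orth_decomp_unique[OF V, THEN conjunct1, of _ _ "x - p'" "x - p"]) (use that p in simp_all)
  qed (rule p)
  then show "orth_proj V x \<in> V" "x - orth_proj V x \<in> V\<^sup>\<bottom>" by auto
qed

lemma orth_proj_eqI:
  fixes V :: "'a::euclidean_space set"
  assumes V: "subspace V" and "p \<in> V" "x - p \<in> V\<^sup>\<bottom>"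
  shows "orth_proj V x = p"
  by (rule orth_decomp_unique[OF V, THEN conjunct1, of _ _ "x - orth_proj V x" "x - p"])
     (use orth_proj[OF V, of x] assms in simp_all)

lemma linear_orth_proj:
  fixes V :: "'a::euclidean_space set"
  assumes V: "subspace V"
  shows "linear (orth_proj V)"
proof (rule linearI)
  note V' = subspace_orthogonal_comp[of V]
  show "orth_proj V (x + y) = orth_proj V x + orth_proj V y" for x y
  proof (rule orth_proj_eqI[OF V])
    show "orth_proj V x + orth_proj V y \<in> V" by (intro subspace_add V orth_proj)
    have "(x - orth_proj V x) + (y - orth_proj V y) \<in> V\<^sup>\<bottom>" by (intro subspace_add V' V orth_proj)
    then show "x + y - (orth_proj V x + orth_proj V y) \<in> V\<^sup>\<bottom>" by (simp add: algebra_simps)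
  qed
  show "orth_proj V (c *\<^sub>R x) = c *\<^sub>R orth_proj V x" for c x
  proof (rule orth_proj_eqI[OF V])
    show "c *\<^sub>R orth_proj V x \<in> V" by (intro subspace_scale V orth_proj)
    have "c *\<^sub>R (x - orth_proj V x) \<in> V\<^sup>\<bottom>" by (intro subspace_scale V' V orth_proj)
    then show "c *\<^sub>R x - c *\<^sub>R orth_proj V x \<in> V\<^sup>\<bottom>" by (simp add: algebra_simps)
  qed
qed

lemma dim_orthogonal_comp:
  fixes V :: "'a::euclidean_space set"
  assumes V: "subspace V"
  shows "dim (V\<^sup>\<bottom>) = DIM('a) - dim V"
  using dim_subspace_orthogonal_to_vectors[OF V subspace_UNIV] by (simp add: orthogonal_comp_def)

text \<open>\<open>T_thick\<close> with the span replaced by an arbitrary subspace, so that the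
  geometric estimates do not involve the dictionary.\<close>

definition slab :: "'a::euclidean_space set \<Rightarrow> ('a \<Rightarrow> real) \<Rightarrow> real \<Rightarrow> 'a set" where
  "slab V nrm \<tau> = {x + y | x y. x \<in> V \<and> y \<in> orth_proj (V\<^sup>\<bottom>) ` level nrm \<tau>}"

lemma T_thick_eq_slab: "T_thick \<psi> nrm \<tau> J = slab (T_span \<psi> J) nrm \<tau>"
  by (simp add: T_thick_def slab_def)

text \<open>Projecting a vector to the complement of V changes it only by an element of V, which the
  summand from V absorbs. Hence adding the projected ball to V gives the same set as adding the ball
  itself; this is the form that matches the constraint in \<open>val\<close>.\<close>

lemma slab_iff:
  fixes V :: "'a::euclidean_space set"
  assumes V: "subspace V" 
  shows "d \<in> slab V nrm \<tau> \<longleftrightarrow> (\<exists>x\<in>V. nrm (d - x) \<le> \<tau>)"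
proof
  note V' = subspace_orthogonal_comp[of V]
  have res: "w - orth_proj (V\<^sup>\<bottom>) w \<in> V" for w
    using orth_proj(2)[OF V', of w] orthogonal_comp_self[OF V] by simp
  {
    assume "d \<in> slab V nrm \<tau>"
    then obtain x w where xw: "x \<in> V" "nrm w \<le> \<tau>" "d = x + orth_proj (V\<^sup>\<bottom>) w"
      unfolding slab_def level_def by auto
    have "x - (w - orth_proj (V\<^sup>\<bottom>) w) \<in> V" by (rule subspace_diff[OF V xw(1) res])
    moreover have "d - (x - (w - orth_proj (V\<^sup>\<bottom>) w)) = w" using xw by simp
    ultimately show "\<exists>x\<in>V. nrm (d - x) \<le> \<tau>" using xw(2) by metis
  next
    assume "\<exists>x\<in>V. nrm (d - x) \<le> \<tau>"
    then obtain x where x: "x \<in> V" "nrm (d - x) \<le> \<tau>" by blast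
    have "x + (d - x - orth_proj (V\<^sup>\<bottom>) (d - x)) \<in> V" by (rule subspace_add[OF V x(1) res])
    moreover have "d = x + (d - x - orth_proj (V\<^sup>\<bottom>) (d - x)) + orth_proj (V\<^sup>\<bottom>) (d - x)" by simp
    moreover have "orth_proj (V\<^sup>\<bottom>) (d - x) \<in> orth_proj (V\<^sup>\<bottom>) ` level nrm \<tau>"
      using x by (auto simp: level_def)
    ultimately show "d \<in> slab V nrm \<tau>" unfolding slab_def by blast
  }
qed

lemma compact_orth_proj_level:
  fixes V :: "'a::euclidean_space set"
  assumes V: "subspace V" and nrm: "is_norm nrm"
  shows "compact (orth_proj V ` level nrm \<tau>)"
proof (rule compact_continuous_image)
  show "continuous_on (level nrm \<tau>) (orth_proj V)"
    by (rule linear_continuous_on[OF linear_conv_bounded_linear[THEN iffD1, OF linear_orth_proj[OF V]]])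
qed (rule compact_level[OF nrm])

lemma closed_slab:
  fixes V :: "'a::euclidean_space set"
  assumes V: "subspace V" and nrm: "is_norm nrm"
  shows "closed (slab V nrm \<tau>)"
proof -
  have "slab V nrm \<tau> = (\<Union>x\<in>V. \<Union>y\<in>orth_proj (V\<^sup>\<bottom>) ` level nrm \<tau>. {x + y})"
    by (auto simp: slab_def)
  then show ?thesis
    using closed_compact_sums[OF closed_subspace[OF V] compact_orth_proj_level[OF subspace_orthogonal_comp nrm]]
    by simp
qed

section \<open>Measure of a slab inside a norm ball\<close>

lemma compact_subspace_Int_level:
  fixes V :: "'a::euclidean_space set"
  assumes V: "subspace V" and f: "is_norm f"
  shows "compact (V \<inter> level f s)"
  using closed_Int_compact[OF closed_subspace[OF V] compact_level[OF f]] .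

lemma measure_subspace_Int_level:
  fixes V :: "'a::euclidean_space set"
  assumes V: "subspace V" and f: "is_norm f" and s: "s > 0"
  shows "measure (subspace_lborel V) (V \<inter> level f s) = s ^ dim V * measure (subspace_lborel V) (V \<inter> level f 1)"
proof -
  have "V \<inter> level f s = (*\<^sub>R) s ` (V \<inter> level f 1)"
  proof -
    have "(*\<^sub>R) s ` V = V"
    proof (intro set_eqI iffI)
      show "x \<in> (*\<^sub>R) s ` V" if "x \<in> V" for x
        using s subspace_scale[OF V that, of "1 / s"] by (intro image_eqI[of _ _ "(1 / s) *\<^sub>R x"]) auto
      show "x \<in> V" if "x \<in> (*\<^sub>R) s ` V" for x
        using that subspace_scale[OF V] by blast
    qed
    moreover have "inj ((*\<^sub>R) s :: 'a \<Rightarrow> 'a)" using s by (auto simp: inj_on_def)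
    ultimately show ?thesis
      using level_scale[OF f s, of 1] image_Int[of "(*\<^sub>R) s" V "level f 1"] by simp
  qed
  moreover have "V \<inter> level f 1 \<in> sets borel"
    using compact_subspace_Int_level[OF V f] by (rule borel_compact)
  ultimately show ?thesis
    using emeasure_subspace_lborel_scale[OF V _ s] s by (simp add: measure_def enn2real_mult)
qed

lemma measure_subspace_orth_proj_level:
  fixes V :: "'a::euclidean_space set"
  assumes V: "subspace V" and nrm: "is_norm nrm" and s: "s > 0"
  shows "measure (subspace_lborel V) (orth_proj V ` level nrm s)
    = s ^ dim V * measure (subspace_lborel V) (orth_proj V ` level nrm 1)"
proof -
  have "orth_proj V ` level nrm s = (*\<^sub>R) s ` (orth_proj V ` level nrm 1)"
    using level_scale[OF nrm s, of 1] linear_scale[OF linear_orth_proj[OF V]]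
    by (simp add: image_image)
  moreover have "orth_proj V ` level nrm 1 \<in> sets borel"
    using compact_orth_proj_level[OF V nrm] by (rule borel_compact)
  ultimately show ?thesis
    using emeasure_subspace_lborel_scale[OF V _ s] s by (simp add: measure_def enn2real_mult)
qed

text \<open>The orthogonal product formula combined with homogeneity in each factor: \<tau> scales
  the complement and s scales V, which accounts for the two exponents.\<close>

lemma measure_orthogonal_product:
  fixes V :: "'a::euclidean_space set"
  assumes V: "subspace V" and nrm: "is_norm nrm" and f: "is_norm f" and \<tau>: "\<tau> > 0" and s: "s > 0"
  shows "measure lborel {x + y | x y. x \<in> V \<inter> level f s \<and> y \<in> orth_proj (V\<^sup>\<bottom>) ` level nrm \<tau>}
    = measure (subspace_lborel (V\<^sup>\<bottom>)) (orth_proj (V\<^sup>\<bottom>) ` level nrm 1) *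
      measure (subspace_lborel V) (V \<inter> level f 1) * \<tau> ^ (DIM('a) - dim V) * s ^ dim V"
    (is "measure lborel ?S = _")
proof -
  note V' = subspace_orthogonal_comp[of V]
  have "measure lborel ?S = measure (subspace_lborel V) (V \<inter> level f s)
      * measure (subspace_lborel (V\<^sup>\<bottom>)) (orth_proj (V\<^sup>\<bottom>) ` level nrm \<tau>)"
    unfolding measure_def enn2real_mult[symmetric]
    using orth_proj(1)[OF V']
    by (intro arg_cong[where f=enn2real] emeasure_lborel_orthogonal_sum V compact_subspace_Int_level
        compact_orth_proj_level V' nrm f) auto
  then show ?thesis
    unfolding measure_subspace_Int_level[OF V f s] measure_subspace_orth_proj_level[OF V' nrm \<tau>]
      dim_orthogonal_comp[OF V] by (simp add: mult_ac)
qed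

text \<open>Both bounds compare the slab with the products \<open>R s\<close>: for s = \<theta> +
  \<delta> * \<tau> the product contains the slab part, for s = \<theta> - \<delta> * \<tau> it is
  contained in it. The constant \<open>C\<close> is that of \<open>C_const\<close> for V.\<close>

lemma measure_slab_level_bounds:
  fixes V :: "'a::euclidean_space set" and nrm f :: "'a \<Rightarrow> real"
  assumes V: "subspace V" and nrm: "is_norm nrm" and f: "is_norm f"
    and \<delta>: "\<delta> \<ge> 0" "\<And>u. u \<in> orth_proj (V\<^sup>\<bottom>) ` level nrm 1 \<Longrightarrow> f u \<le> \<delta>"
    and \<tau>: "\<tau> > 0" and \<theta>: "\<theta> > 0" "\<theta> \<ge> \<delta> * \<tau>"
  defines "C \<equiv> measure (subspace_lborel (V\<^sup>\<bottom>)) (orth_proj (V\<^sup>\<bottom>) ` level nrm 1) *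
      measure (subspace_lborel V) (V \<inter> level f 1)"
  shows "measure lborel (slab V nrm \<tau> \<inter> level f \<theta>) \<le> C * \<tau> ^ (DIM('a) - dim V) * (\<theta> + \<delta> * \<tau>) ^ dim V"
    and "C * \<tau> ^ (DIM('a) - dim V) * (\<theta> - \<delta> * \<tau>) ^ dim V \<le> measure lborel (slab V nrm \<tau> \<inter> level f \<theta>)"
proof -
  note V' = subspace_orthogonal_comp[of V]
  define R where "R s = {x + y | x y. x \<in> V \<inter> level f s \<and> y \<in> orth_proj (V\<^sup>\<bottom>) ` level nrm \<tau>}" for s
  have R: "measure lborel (R s) = C * \<tau> ^ (DIM('a) - dim V) * s ^ dim V" if "s > 0" for s
    unfolding R_def C_def by (rule measure_orthogonal_product[OF V nrm f \<tau> that])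
  have cR: "compact (R s)" for s
    unfolding R_def by (intro compact_sums compact_subspace_Int_level compact_orth_proj_level V V' nrm f)
  have cS: "compact (slab V nrm \<tau> \<inter> level f \<theta>)"
    by (intro closed_Int_compact closed_slab compact_level V nrm f)
  have fy: "f y \<le> \<delta> * \<tau>" if y: "y \<in> orth_proj (V\<^sup>\<bottom>) ` level nrm \<tau>" for y
  proof -
    have "level nrm \<tau> = (*\<^sub>R) \<tau> ` level nrm 1" using level_scale[OF nrm \<tau>, of 1] by simp
    then obtain w where "w \<in> level nrm 1" "y = \<tau> *\<^sub>R orth_proj (V\<^sup>\<bottom>) w"
      using y linear_scale[OF linear_orth_proj[OF V']] by auto
    then have "f y = \<tau> * f (orth_proj (V\<^sup>\<bottom>) w)" "f (orth_proj (V\<^sup>\<bottom>) w) \<le> \<delta>"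
      using \<tau> \<delta>(2) by (auto simp: is_normD(3)[OF f])
    then show ?thesis using \<tau> by (simp add: mult.commute mult_left_mono)
  qed
  show "measure lborel (slab V nrm \<tau> \<inter> level f \<theta>) \<le> C * \<tau> ^ (DIM('a) - dim V) * (\<theta> + \<delta> * \<tau>) ^ dim V"
  proof -
    have "slab V nrm \<tau> \<inter> level f \<theta> \<subseteq> R (\<theta> + \<delta> * \<tau>)"
    proof
      fix z assume "z \<in> slab V nrm \<tau> \<inter> level f \<theta>"
      then obtain x y where z: "z = x + y" "x \<in> V" "y \<in> orth_proj (V\<^sup>\<bottom>) ` level nrm \<tau>" "f (x + y) \<le> \<theta>"
        by (auto simp: slab_def level_def)
      have "f x \<le> f (x + y) + f (- y)" using is_normD(4)[OF f, of "x + y" "- y"] by simp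
      then have "f x \<le> \<theta> + \<delta> * \<tau>" using fy[OF z(3)] z(4) is_norm_minus[OF f, of y] by simp
      then show "z \<in> R (\<theta> + \<delta> * \<tau>)" using z unfolding R_def level_def by blast
    qed
    then have "measure lborel (slab V nrm \<tau> \<inter> level f \<theta>) \<le> measure lborel (R (\<theta> + \<delta> * \<tau>))"
      using cR cS by (intro measure_mono_fmeasurable fmeasurable_compact) (auto intro: borel_compact)
    also have "\<dots> = C * \<tau> ^ (DIM('a) - dim V) * (\<theta> + \<delta> * \<tau>) ^ dim V"
      using \<delta>(1) \<tau> \<theta> by (intro R) (simp add: add_pos_nonneg)
    finally show ?thesis .
  qed
  show "C * \<tau> ^ (DIM('a) - dim V) * (\<theta> - \<delta> * \<tau>) ^ dim V \<le> measure lborel (slab V nrm \<tau> \<inter> level f \<theta>)"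
  proof -
    \<comment> \<open>The second premise on \<open>s\<close> asks only about points of V, instead of
      s \<le> \<theta> - \<delta> * \<tau>; thus s = 1 is admissible when V = {0}, where the radius
      does not enter the value because s ^ 0 = 1.\<close>
    have low: "C * \<tau> ^ (DIM('a) - dim V) * s ^ dim V \<le> measure lborel (slab V nrm \<tau> \<inter> level f \<theta>)"
      if s: "s > 0" and Vs: "\<And>x. x \<in> V \<Longrightarrow> f x \<le> s \<Longrightarrow> f x \<le> \<theta> - \<delta> * \<tau>" for s
    proof -
      have "R s \<subseteq> slab V nrm \<tau> \<inter> level f \<theta>"
      proof
        fix z assume "z \<in> R s"
        then obtain x y where z: "z = x + y" "x \<in> V" "f x \<le> s" "y \<in> orth_proj (V\<^sup>\<bottom>) ` level nrm \<tau>"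
          by (auto simp: R_def level_def)
        have "f (x + y) \<le> \<theta>" using is_normD(4)[OF f, of x y] fy[OF z(4)] Vs[OF z(2,3)] by simp
        then show "z \<in> slab V nrm \<tau> \<inter> level f \<theta>" using z unfolding slab_def level_def by blast
      qed
      then have "measure lborel (R s) \<le> measure lborel (slab V nrm \<tau> \<inter> level f \<theta>)"
        using cR cS by (intro measure_mono_fmeasurable fmeasurable_compact) (auto intro: borel_compact)
      then show ?thesis using R[OF s] by simp
    qed
    \<comment> \<open>If \<open>\<theta> = \<delta> * \<tau>\<close> and \<open>V = {0}\<close>, the factor \<open>0 ^ 0 = 1\<close> makes the bound nontrivial.\<close>
    consider "\<theta> - \<delta> * \<tau> > 0" | "\<theta> - \<delta> * \<tau> = 0" "dim V > 0" | "dim V = 0" using \<theta> by linarith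
    then show ?thesis
    proof cases
      case 1 then show ?thesis by (rule low)
    next
      case 2 then show ?thesis by (simp only: zero_power mult_zero_right measure_nonneg)
    next
      case 3
      then have "V \<subseteq> {0}" by (simp add: dim_eq_0)
      then have "f x \<le> \<theta> - \<delta> * \<tau>" if "x \<in> V" for x
        using that \<theta> is_normD(2)[OF f, of x] by auto
      then show ?thesis using low[of 1] unfolding 3 by simp
    qed
  qed
qed

section \<open>Sparse representations and overlaps\<close>

text \<open>Adding one dictionary vector raises the dimension by at most 1, so no dimension up to
  that of the full span is skipped.\<close>

lemma T_span_extend:
  fixes \<psi> :: "'i \<Rightarrow> 'a::euclidean_space"
  assumes fin: "finite I" and J: "J \<subseteq> I" and K: "dim (T_span \<psi> J) \<le> K" "K \<le> dim (T_span \<psi> I)"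
  shows "\<exists>J'. J \<subseteq> J' \<and> J' \<subseteq> I \<and> dim (T_span \<psi> J') = K"
  using J K
proof (induction "card (I - J)" arbitrary: J rule: less_induct)
  case less
  show ?case
  proof (cases "dim (T_span \<psi> J) = K")
    case True
    then show ?thesis using less.prems by blast
  next
    case False
    then have "J \<noteq> I" using less.prems by auto
    then obtain i where i: "i \<in> I" "i \<notin> J" using less.prems by blast
    have "card (I - insert i J) < card (I - J)"
      using fin i by (intro psubset_card_mono) auto
    moreover have "dim (T_span \<psi> (insert i J)) \<le> dim (T_span \<psi> J) + 1"
      by (simp add: T_span_def dim_insert)
    ultimately have "\<exists>J'. insert i J \<subseteq> J' \<and> J' \<subseteq> I \<and> dim (T_span \<psi> J') = K"
      using less.prems False i by (intro less.hyps) auto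
    then show ?thesis by blast
  qed
qed

lemma dim_T_span_le_card:
  fixes \<psi> :: "'i \<Rightarrow> 'a::euclidean_space"
  assumes "finite J"
  shows "dim (T_span \<psi> J) \<le> card J"
proof -
  have "dim (T_span \<psi> J) \<le> card (\<psi> ` J)"
    unfolding T_span_def using assms by (intro dim_le_card) auto
  also have "\<dots> \<le> card J" by (rule card_image_le[OF assms])
  finally show ?thesis .
qed

text \<open>A basis of the span is taken among the vectors of \<open>J\<close> themselves. Repeated
  dictionary vectors are harmless, since \<open>U\<close> selects one index for each basis vector.
  The bound by the dimension, instead of \<open>card J\<close>, is what puts the points of a slab
  into the event val \<le> K.\<close>

lemma T_span_sparse_representation:
  fixes \<psi> :: "'i \<Rightarrow> 'a::euclidean_space"
  assumes fin: "finite I" and J: "J \<subseteq> I" and x: "x \<in> T_span \<psi> J"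
  shows "\<exists>l. x = (\<Sum>i\<in>I. l i *\<^sub>R \<psi> i) \<and> card {i\<in>I. l i \<noteq> 0} \<le> dim (T_span \<psi> J)"
proof -
  obtain B where B: "B \<subseteq> \<psi> ` J" "independent B" "\<psi> ` J \<subseteq> span B" "card B = dim (\<psi> ` J)"
    by (rule basis_exists)
  obtain U where U: "U \<subseteq> J" "inj_on \<psi> U" "B = \<psi> ` U"
    using B(1) subset_image_inj[of B \<psi> J] by blast
  have finU: "finite U" using U(1) J fin by (meson finite_subset)
  have "span (\<psi> ` J) \<subseteq> span B" by (rule span_minimal[OF B(3)]) simp
  then have "x \<in> span (\<psi> ` U)" using x U(3) by (auto simp: T_span_def)
  then obtain u where u: "x = (\<Sum>b\<in>\<psi> ` U. u b *\<^sub>R b)"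
    using span_finite[of "\<psi> ` U"] finU by auto
  define l where "l i = (if i \<in> U then u (\<psi> i) else 0)" for i
  have "x = (\<Sum>i\<in>U. u (\<psi> i) *\<^sub>R \<psi> i)" unfolding u using U(2) by (simp add: sum.reindex)
  also have "\<dots> = (\<Sum>i\<in>I. l i *\<^sub>R \<psi> i)"
    using U(1) J fin by (intro sum.mono_neutral_cong_left) (auto simp: l_def)
  finally have "x = (\<Sum>i\<in>I. l i *\<^sub>R \<psi> i)" .
  moreover have "card {i\<in>I. l i \<noteq> 0} \<le> card U"
    using finU by (intro card_mono) (auto simp: l_def split: if_splits)
  moreover have "card U = dim (T_span \<psi> J)"
    using B(4) U(2,3) by (simp add: T_span_def card_image)
  ultimately show ?thesis by auto
qed

lemma val_le_iff:
  fixes \<psi> :: "'i \<Rightarrow> 'a::euclidean_space"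
  assumes fin: "finite I" and spn: "span (\<psi> ` I) = UNIV" and nrm: "is_norm nrm" and \<tau>: "\<tau> > 0"
    and rep: "representatives I \<psi> K R" and K: "K \<le> DIM('a)"
  shows "val I \<psi> nrm \<tau> d \<le> K \<longleftrightarrow> (\<exists>J\<in>R. d \<in> T_thick \<psi> nrm \<tau> J)"
proof
  let ?P = "\<lambda>n. \<exists>l :: 'i \<Rightarrow> real. nrm ((\<Sum>i\<in>I. l i *\<^sub>R \<psi> i) - d) \<le> \<tau> \<and> n = card {i \<in> I. l i \<noteq> 0}"
  have sub: "subspace (T_span \<psi> J)" for J by (simp add: T_span_def)
  {
    assume le: "val I \<psi> nrm \<tau> d \<le> K"
    \<comment> \<open>The dictionary spans the space, so the problem is feasible and the
      \<open>LEAST\<close> in \<open>val\<close> is attained.\<close>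
    obtain l0 where "d = (\<Sum>i\<in>I. l0 i *\<^sub>R \<psi> i)"
      using T_span_sparse_representation[OF fin subset_refl, of d \<psi>] spn by (auto simp: T_span_def)
    then have "?P (card {i \<in> I. l0 i \<noteq> 0})"
      using \<tau> is_normD(2)[OF nrm, of 0] by (intro exI[of _ l0]) simp
    then have "?P (val I \<psi> nrm \<tau> d)" unfolding val_def by (rule LeastI)
    then obtain l where l: "nrm ((\<Sum>i\<in>I. l i *\<^sub>R \<psi> i) - d) \<le> \<tau>" "card {i \<in> I. l i \<noteq> 0} \<le> K"
      using le by auto
    define J0 where "J0 = {i \<in> I. l i \<noteq> 0}"
    have J0: "J0 \<subseteq> I" "finite J0" using fin by (auto simp: J0_def)
    \<comment> \<open>The support may span less than K dimensions; \<open>J1\<close> fills it up to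
      exactly K, so that a representative with the same span exists.\<close>
    have "dim (T_span \<psi> J0) \<le> K" using dim_T_span_le_card[OF J0(2), of \<psi>] l(2) by (simp add: J0_def)
    moreover have "K \<le> dim (T_span \<psi> I)" using spn K by (simp add: T_span_def)
    ultimately obtain J1 where J1: "J0 \<subseteq> J1" "J1 \<subseteq> I" "dim (T_span \<psi> J1) = K"
      using T_span_extend[OF fin J0(1)] by blast
    then obtain J where J: "J \<in> R" "T_span \<psi> J = T_span \<psi> J1"
      using rep unfolding representatives_def by blast
    have "(\<Sum>i\<in>I. l i *\<^sub>R \<psi> i) = (\<Sum>i\<in>J0. l i *\<^sub>R \<psi> i)"
      using fin by (intro sum.mono_neutral_right) (auto simp: J0_def)
    also have "\<dots> \<in> T_span \<psi> J1"
      unfolding T_span_def using J1(1) by (intro span_sum span_scale span_base) auto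
    finally have "(\<Sum>i\<in>I. l i *\<^sub>R \<psi> i) \<in> T_span \<psi> J" using J(2) by simp
    moreover have "nrm (d - (\<Sum>i\<in>I. l i *\<^sub>R \<psi> i)) \<le> \<tau>"
      using l(1) is_norm_minus[OF nrm, of "d - (\<Sum>i\<in>I. l i *\<^sub>R \<psi> i)"] by simp
    ultimately have "d \<in> T_thick \<psi> nrm \<tau> J"
      unfolding T_thick_eq_slab slab_iff[OF sub] by blast
    with J(1) show "\<exists>J\<in>R. d \<in> T_thick \<psi> nrm \<tau> J" by blast
  next
    assume "\<exists>J\<in>R. d \<in> T_thick \<psi> nrm \<tau> J"
    then obtain J x where J: "J \<in> R" "x \<in> T_span \<psi> J" "nrm (d - x) \<le> \<tau>"
      unfolding T_thick_eq_slab slab_iff[OF sub] by blast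
    then have JI: "J \<subseteq> I" "dim (T_span \<psi> J) = K" using rep by (auto simp: representatives_def)
    obtain l where l: "x = (\<Sum>i\<in>I. l i *\<^sub>R \<psi> i)" "card {i\<in>I. l i \<noteq> 0} \<le> K"
      using T_span_sparse_representation[OF fin JI(1) J(2)] JI(2) by auto
    have "nrm (x - d) \<le> \<tau>" using J(3) is_norm_minus[OF nrm, of "x - d"] by simp
    then have "?P (card {i\<in>I. l i \<noteq> 0})" using l(1) by blast
    then have "val I \<psi> nrm \<tau> d \<le> card {i\<in>I. l i \<noteq> 0}" unfolding val_def by (rule Least_le)
    then show "val I \<psi> nrm \<tau> d \<le> K" using l(2) by simp
  }
qed

section \<open>Inclusion-exclusion and intersections of distinct spans\<close>

text \<open>The subtracted sum runs over ordered pairs, so every overlap is counted twice. This is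
  weaker than the sharp inequality but agrees with \<open>H_pairs\<close>, which also consists of
  ordered pairs.\<close>

lemma bonferroni_lower:
  fixes S :: "'a set"
  assumes fin: "finite S" and A: "\<And>i. i \<in> S \<Longrightarrow> A i \<in> fmeasurable M"
  shows "(\<Sum>i\<in>S. measure M (A i)) - (\<Sum>(i, j)\<in>{(i, j). i \<in> S \<and> j \<in> S \<and> i \<noteq> j}. measure M (A i \<inter> A j))
    \<le> measure M (\<Union>i\<in>S. A i)"
  using assms
proof (induction S rule: finite_induct)
  case (insert a S)
  let ?D = "\<lambda>S. {(i, j). i \<in> S \<and> j \<in> S \<and> i \<noteq> j}"
  let ?m = "\<lambda>(i, j). measure M (A i \<inter> A j)"
  have Aa: "A a \<in> fmeasurable M" and AS: "\<And>i. i \<in> S \<Longrightarrow> A i \<in> fmeasurable M"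
    using insert.prems by simp_all
  have fU: "(\<Union>i\<in>S. A i) \<in> fmeasurable M"
    using AS insert.hyps(1) by (intro fmeasurable.finite_UN)
  have IH: "(\<Sum>i\<in>S. measure M (A i)) - sum ?m (?D S) \<le> measure M (\<Union>i\<in>S. A i)"
    by (rule insert.IH[OF AS])
  have "measure M (A a \<inter> (\<Union>i\<in>S. A i)) = measure M (\<Union>i\<in>S. A a \<inter> A i)"
    by (simp only: Int_UN_distrib)
  also have "\<dots> \<le> (\<Sum>i\<in>S. measure M (A a \<inter> A i))"
    using insert.hyps(1) fmeasurableD[OF Aa] fmeasurableD[OF AS] by (intro measure_UNION_le sets.Int)
  finally have 1: "measure M (A a \<inter> (\<Union>i\<in>S. A i)) \<le> (\<Sum>i\<in>S. measure M (A a \<inter> A i))" .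
  have finD: "finite (?D S)" if "finite S" for S :: "'a set"
    by (rule finite_subset[of _ "S \<times> S"]) (use that in auto)
  have "sum ?m (?D S) + (\<Sum>i\<in>S. measure M (A a \<inter> A i)) = sum ?m (?D S) + sum ?m (Pair a ` S)"
    by (subst sum.reindex) (simp_all add: inj_on_def)
  also have "\<dots> = sum ?m (?D S \<union> Pair a ` S)"
    using insert.hyps by (intro sum.union_disjoint[symmetric] finD) auto
  \<comment> \<open>Of the new pairs only those with first entry \<open>a\<close> are used; the
    mirrored ones are nonnegative and enlarge the right-hand side.\<close>
  also have "\<dots> \<le> sum ?m (?D (insert a S))"
    using insert.hyps by (intro sum_mono2 finD) auto
  finally have 2: "sum ?m (?D S) + (\<Sum>i\<in>S. measure M (A a \<inter> A i)) \<le> sum ?m (?D (insert a S))" .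
  have "measure M (\<Union>i\<in>insert a S. A i)
      = measure M (A a) + measure M (\<Union>i\<in>S. A i) - measure M (A a \<inter> (\<Union>i\<in>S. A i))"
    using measure_Un3[OF Aa fU] by simp
  moreover have "(\<Sum>i\<in>insert a S. measure M (A i)) = measure M (A a) + (\<Sum>i\<in>S. measure M (A i))"
    using insert.hyps by simp
  ultimately show ?case using IH 1 2 by linarith
qed simp

text \<open>Intersection dimension K would make both spans equal, against injectivity of
  \<open>T_span\<close> on the representatives; the lower limit is the dimension formula for the sum
  of two subspaces. Positivity of K matters because of truncated subtraction: for K = 0 the index
  range would be {0} and would admit the pair of the empty set with itself.\<close>

lemma H_pairs_partition:
  fixes \<psi> :: "'i \<Rightarrow> 'a::euclidean_space"
  assumes rep: "representatives I \<psi> K (\<J> K)" and K: "0 < K"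
  shows "{(J1, J2). J1 \<in> \<J> K \<and> J2 \<in> \<J> K \<and> J1 \<noteq> J2}
    = (\<Union>k\<in>{k_min DIM('a) K..K - 1}. H_pairs \<psi> \<J> K k)"
proof (intro set_eqI iffI; clarify)
  have sub: "subspace (T_span \<psi> J)" for J by (simp add: T_span_def)
  have dimK: "dim (T_span \<psi> J) = K" if "J \<in> \<J> K" for J
    using rep that by (auto simp: representatives_def)
  {
    fix J1 J2 assume J: "J1 \<in> \<J> K" "J2 \<in> \<J> K" "J1 \<noteq> J2"
    let ?k = "dim (T_span \<psi> J1 \<inter> T_span \<psi> J2)"
    have "?k \<noteq> K"
    proof
      assume "?k = K"
      then have "T_span \<psi> J1 \<inter> T_span \<psi> J2 = T_span \<psi> J1" "T_span \<psi> J1 \<inter> T_span \<psi> J2 = T_span \<psi> J2"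
        using dimK J by (intro subspace_dim_equal subspace_inter sub; simp)+
      then have "T_span \<psi> J1 = T_span \<psi> J2" by simp
      then show False using rep J by (auto simp: representatives_def inj_on_def)
    qed
    moreover have "?k \<le> K" using dim_subset[of "T_span \<psi> J1 \<inter> T_span \<psi> J2" "T_span \<psi> J1"] dimK[OF J(1)] by simp
    moreover have "2 * K - DIM('a) \<le> ?k"
      using dim_sums_Int[OF sub[of J1] sub[of J2]] dimK[OF J(1)] dimK[OF J(2)]
        dim_subset_UNIV[of "{x + y |x y. x \<in> T_span \<psi> J1 \<and> y \<in> T_span \<psi> J2}"] by linarith
    ultimately have "?k \<in> {k_min DIM('a) K..K - 1}" using K by (simp add: k_min_def)
    then show "(J1, J2) \<in> (\<Union>k\<in>{k_min DIM('a) K..K - 1}. H_pairs \<psi> \<J> K k)"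
      using J by (auto simp: H_pairs_def)
  next
    fix J1 J2 k assume k: "k \<in> {k_min DIM('a) K..K - 1}" and "(J1, J2) \<in> H_pairs \<psi> \<J> K k"
    then have J: "J1 \<in> \<J> K" "J2 \<in> \<J> K" "dim (T_span \<psi> J1 \<inter> T_span \<psi> J2) = k"
      by (auto simp: H_pairs_def)
    have "J1 \<noteq> J2"
    proof
      assume "J1 = J2" then show False using J dimK[of J1] k K by auto
    qed
    then show "J1 \<in> \<J> K \<and> J2 \<in> \<J> K \<and> J1 \<noteq> J2" using J by blast
  }
qed

text \<open>There is only one subspace of dimension 0 and only one of full dimension. Hence there
  are no overlaps in these cases, in accordance with \<open>epsilon0\<close> being 0 there.\<close>

lemma representatives_unique_extreme:
  fixes \<psi> :: "'i \<Rightarrow> 'a::euclidean_space"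
  assumes rep: "representatives I \<psi> K R" and K: "K = 0 \<or> K = DIM('a)"
    and J: "J1 \<in> R" "J2 \<in> R"
  shows "J1 = J2"
proof -
  have sub: "subspace (T_span \<psi> J)" for J by (simp add: T_span_def)
  have "T_span \<psi> J = (if K = 0 then {0} else UNIV)" if "J \<in> R" for J
  proof -
    have d: "dim (T_span \<psi> J) = K" using rep that by (auto simp: representatives_def)
    show ?thesis
    proof (cases "K = 0")
      case True
      then show ?thesis using d subspace_0[OF sub, of J] by (auto simp: dim_eq_0)
    next
      case False
      then have "T_span \<psi> J = UNIV" using d K by (intro subspace_dim_equal sub) auto
      then show ?thesis using False by simp
    qed
  qed
  then show ?thesis using rep J by (simp add: representatives_def inj_on_def)
qed

section \<open>The uniform law and normalization by the volume of the ball\<close>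

lemma subspace_lborel_UNIV: "subspace_lborel (UNIV :: 'a::euclidean_space set) = lborel"
proof -
  obtain B :: "'a set" where B: "orthonormal_basis_of UNIV B"
    and eq: "subspace_lborel UNIV = distr (PiM B (\<lambda>_. lborel)) borel (\<lambda>c. \<Sum>b\<in>B. c b *\<^sub>R b)"
    using subspace_lborel_basis[OF subspace_UNIV] by blast
  show ?thesis by (rule trans[OF eq lborel_eq_orthonormal_basis[OF B]])
qed

lemma measure_level:
  fixes f :: "'a::euclidean_space \<Rightarrow> real"
  assumes f: "is_norm f" and s: "s > 0"
  shows "measure lborel (level f s) = s ^ DIM('a) * measure lborel (level f 1)"
  using measure_subspace_Int_level[OF subspace_UNIV f s] by (simp add: subspace_lborel_UNIV)

text \<open>The value t = 1 belongs to the set whose infimum is taken. This turns the assumed bound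
  by \<delta> times the gauge into a bound by \<delta> on the projected unit ball.\<close>

lemma h_gauge_le_1:
  assumes "u \<in> orth_proj ((T_span \<psi> J)\<^sup>\<bottom>) ` level nrm 1"
  shows "h_gauge \<psi> nrm J u \<le> 1"
  unfolding h_gauge_def using assms by (intro cInf_lower bdd_belowI[of _ 0]) auto

lemma uniformly_distributed_level:
  fixes f :: "'a::euclidean_space \<Rightarrow> real"
  assumes f: "is_norm f" and X: "uniformly_distributed M X (level f \<theta>)"
  shows "0 < \<theta>" "0 < measure lborel (level f \<theta>)"
    and "closed U \<Longrightarrow> \<P>(\<omega> in M. X \<omega> \<in> U) = measure lborel (U \<inter> level f \<theta>) / measure lborel (level f \<theta>)"
proof -
  let ?L = "level f \<theta>"
  have L: "?L \<in> sets lborel" using compact_level[OF f] by (simp add: borel_compact)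
  have fin: "emeasure lborel ?L \<noteq> \<infinity>" using emeasure_compact_finite[OF compact_level[OF f, of \<theta>]] by simp
  have M: "prob_space M" and [measurable]: "X \<in> borel_measurable M"
    and D: "distr M lborel X = uniform_measure lborel ?L"
    using X by (auto simp: uniformly_distributed_def)
  interpret prob_space M by fact
  have "prob_space (uniform_measure lborel ?L)"
    unfolding D[symmetric] by (rule prob_space_distr) simp
  then have "emeasure (uniform_measure lborel ?L) (space (uniform_measure lborel ?L)) = 1"
    by (rule prob_space.emeasure_space_1)
  \<comment> \<open>In \<open>ennreal\<close> 0 / 0 = 0, so total mass 1 excludes a null level set,
    and with it any \<theta> \<le> 0.\<close>
  then have "emeasure lborel ?L / emeasure lborel ?L = 1"
    using L by simp
  then have nz: "emeasure lborel ?L \<noteq> 0" by auto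
  then show pos: "0 < measure lborel ?L"
    using fin by (simp add: measure_def enn2real_positive_iff less_top zero_less_iff_neq_zero)
  show "0 < \<theta>"
  proof (rule ccontr)
    assume "\<not> 0 < \<theta>"
    then have "?L \<subseteq> {0}"
      using is_normD(1,2)[OF f] unfolding level_def by (smt (verit) mem_Collect_eq singletonI subsetI)
    then have "emeasure lborel ?L \<le> emeasure lborel {0::'a}" by (intro emeasure_mono) auto
    then show False using nz by simp
  qed
  assume U: "closed U"
  have "\<P>(\<omega> in M. X \<omega> \<in> U) = measure (distr M lborel X) U"
    using U by (subst measure_distr) (auto intro!: arg_cong[where f="measure M"])
  also have "\<dots> = measure lborel (U \<inter> ?L) / measure lborel ?L"
    unfolding D using U by (subst measure_uniform_measure[OF nz fin]) (simp_all add: Int_commute)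
  finally show "\<P>(\<omega> in M. X \<omega> \<in> U) = measure lborel (U \<inter> ?L) / measure lborel ?L" .
qed

lemma delta_hat_le_Delta: "delta_hat \<J> \<delta> K \<le> Delta \<psi> \<J> \<delta> \<delta>' K"
  by (cases K) (auto simp del: Max_insert Un_insert_left intro: Max_ge)

lemma delta'_hat_le_Delta:
  fixes \<psi> :: "'i \<Rightarrow> 'a::euclidean_space"
  assumes "0 < K" "K < DIM('a)" "k \<in> {k_min DIM('a) K..K - 1}"
  shows "delta'_hat \<psi> \<J> \<delta>' K k \<le> Delta \<psi> \<J> \<delta> \<delta>' K"
  using assms by (cases K) (auto simp del: Max_insert Un_insert_left intro!: Max_ge)

text \<open>Homogeneity of degree N in (\<tau>, \<theta>). The sign of \<open>c\<close> is free, so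
  the same identity serves the upper bound, the lower bound and the overlaps.\<close>

lemma power_ratio_factor:
  fixes \<tau> \<theta> c :: real
  assumes "\<theta> > 0" "k \<le> N"
  shows "\<tau> ^ (N - k) * (\<theta> + c * \<tau>) ^ k = \<theta> ^ N * ((\<tau> / \<theta>) ^ (N - k) * (1 + c * (\<tau> / \<theta>)) ^ k)"
proof -
  have \<theta>N: "\<theta> ^ N = \<theta> ^ (N - k) * \<theta> ^ k" using assms by (simp add: power_add[symmetric])
  have "\<theta> * (\<tau> / \<theta>) = \<tau>" "\<theta> * (1 + c * (\<tau> / \<theta>)) = \<theta> + c * \<tau>"
    using assms by (simp_all add: field_simps)
  then have "\<tau> ^ (N - k) * (\<theta> + c * \<tau>) ^ k
    = (\<theta> * (\<tau> / \<theta>)) ^ (N - k) * (\<theta> * (1 + c * (\<tau> / \<theta>))) ^ k" by (simp only:)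
  then show ?thesis unfolding \<theta>N power_mult_distrib by (simp only: mult_ac)
qed

section \<open>Total overlap and the error term\<close>

lemma Q_const_nonneg: "0 \<le> Q_const \<psi> f \<delta>\<^sub>2 p"
  by (cases p) (simp add: Q_const_def Let_def)

lemma C_const_nonneg: "0 \<le> C_const \<psi> nrm f J"
  by (simp add: C_const_def)

lemma finite_representatives:
  assumes "representatives I \<psi> K R" "finite I"
  shows "finite R"
proof -
  have "R \<subseteq> Pow I" using assms(1) by (auto simp: representatives_def)
  then show ?thesis using assms(2) by (meson finite_Pow_iff finite_subset)
qed

lemma finite_H_pairs: "finite (\<J> K) \<Longrightarrow> finite (H_pairs \<psi> \<J> K k)"
  by (rule finite_subset[of _ "\<J> K \<times> \<J> K"]) (auto simp: H_pairs_def)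

text \<open>Ordered pairs are sorted by the dimension k of the intersection, and in each class the
  individual constants are replaced by their maximum. Since \<open>Delta\<close> dominates that
  maximum, the condition on \<theta> activates the assumed estimate for every pair.\<close>

lemma measure_pairs_le_epsilon0:
  fixes \<psi> :: "'i \<Rightarrow> 'a::euclidean_space"
  assumes rep: "representatives I \<psi> K (\<J> K)" and finJ: "finite (\<J> K)" and K: "K \<le> DIM('a)"
    and \<delta>': "\<And>k J1 J2. k < K \<Longrightarrow> (J1, J2) \<in> H_pairs \<psi> \<J> K k \<Longrightarrow> 0 \<le> \<delta>' (J1, J2)"
      "\<And>k J1 J2. k < K \<Longrightarrow> (J1, J2) \<in> H_pairs \<psi> \<J> K k \<Longrightarrow> \<theta> \<ge> \<delta>' (J1, J2) * \<tau> \<Longrightarrow>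
        m J1 J2 \<le> Q_const \<psi> f \<delta>\<^sub>2 (J1, J2) * \<tau> ^ (DIM('a) - k) * (\<theta> + \<delta>' (J1, J2) * \<tau>) ^ k"
    and \<tau>: "\<tau> > 0" and \<theta>: "\<theta> > 0" "\<theta> \<ge> \<tau> * Delta \<psi> \<J> \<delta> \<delta>' K"
  shows "(\<Sum>(J1, J2)\<in>{(J1, J2). J1 \<in> \<J> K \<and> J2 \<in> \<J> K \<and> J1 \<noteq> J2}. m J1 J2)
    \<le> \<theta> ^ DIM('a) * epsilon0 \<psi> f \<delta>\<^sub>2 \<J> \<delta>' K \<tau> \<theta>"
proof (cases "0 < K \<and> K < DIM('a)")
  case False
  then have "K = 0 \<or> K = DIM('a)" using K by auto
  then have "{(J1, J2). J1 \<in> \<J> K \<and> J2 \<in> \<J> K \<and> J1 \<noteq> J2} = {}"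
    using representatives_unique_extreme[OF rep] by blast
  then show ?thesis using False by (simp only: sum.empty epsilon0_def if_False mult_zero_right order_refl)
next
  case True
  let ?N = "DIM('a)" and ?ks = "{k_min DIM('a) K..K - 1}" and ?dh = "delta'_hat \<psi> \<J> \<delta>' K"
  have finH: "finite (H_pairs \<psi> \<J> K k)" for k by (rule finite_H_pairs[where ?\<J> = \<J>, OF finJ])
  have bound: "m J1 J2 \<le> Q_const \<psi> f \<delta>\<^sub>2 (J1, J2) * (\<theta> ^ ?N * ((\<tau> / \<theta>) ^ (?N - k) * (1 + ?dh k * (\<tau> / \<theta>)) ^ k))"
    if k: "k \<in> ?ks" and H: "(J1, J2) \<in> H_pairs \<psi> \<J> K k" for k J1 J2
  proof -
    have kK: "k < K" "k \<le> ?N" using k True by auto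
    have d: "\<delta>' (J1, J2) \<le> ?dh k"
      unfolding delta'_hat_def using finH H by (intro Max_ge) auto
    then have "\<delta>' (J1, J2) \<le> Delta \<psi> \<J> \<delta> \<delta>' K"
      using delta'_hat_le_Delta[OF _ _ k, of \<psi> \<J> \<delta>' \<delta>] True by linarith
    then have "\<delta>' (J1, J2) * \<tau> \<le> \<theta>"
      using \<theta>(2) \<tau> by (metis mult.commute mult_left_mono less_imp_le order_trans)
    then have "m J1 J2 \<le> Q_const \<psi> f \<delta>\<^sub>2 (J1, J2) * \<tau> ^ (?N - k) * (\<theta> + \<delta>' (J1, J2) * \<tau>) ^ k"
      by (rule \<delta>'(2)[OF kK(1) H])
    \<comment> \<open>Nonnegativity of the pair's constant keeps the smaller base nonnegative, as
      monotonicity of the power demands.\<close>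
    also have "\<dots> \<le> Q_const \<psi> f \<delta>\<^sub>2 (J1, J2) * \<tau> ^ (?N - k) * (\<theta> + ?dh k * \<tau>) ^ k"
      using d \<tau> \<theta>(1) \<delta>'(1)[OF kK(1) H]
      by (intro mult_left_mono power_mono add_left_mono mult_right_mono mult_nonneg_nonneg Q_const_nonneg) auto
    also have "\<dots> = Q_const \<psi> f \<delta>\<^sub>2 (J1, J2) * (\<theta> ^ ?N * ((\<tau> / \<theta>) ^ (?N - k) * (1 + ?dh k * (\<tau> / \<theta>)) ^ k))"
      unfolding power_ratio_factor[OF \<theta>(1) kK(2), symmetric] by (simp only: mult.assoc)
    finally show ?thesis .
  qed
  have "(\<Sum>(J1, J2)\<in>{(J1, J2). J1 \<in> \<J> K \<and> J2 \<in> \<J> K \<and> J1 \<noteq> J2}. m J1 J2)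
    = (\<Sum>k\<in>?ks. \<Sum>(J1, J2)\<in>H_pairs \<psi> \<J> K k. m J1 J2)"
    unfolding H_pairs_partition[where ?\<J> = \<J>, OF rep True[THEN conjunct1]]
    using finH by (intro sum.UNION_disjoint) (auto simp: H_pairs_def)
  also have "\<dots> \<le> (\<Sum>k\<in>?ks. \<Sum>p\<in>H_pairs \<psi> \<J> K k.
      Q_const \<psi> f \<delta>\<^sub>2 p * (\<theta> ^ ?N * ((\<tau> / \<theta>) ^ (?N - k) * (1 + ?dh k * (\<tau> / \<theta>)) ^ k)))"
    using bound by (intro sum_mono) auto
  also have "\<dots> = \<theta> ^ ?N * epsilon0 \<psi> f \<delta>\<^sub>2 \<J> \<delta>' K \<tau> \<theta>"
    using True by (simp add: epsilon0_def Q_bar_def sum_distrib_left sum_distrib_right mult_ac)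
  finally show ?thesis .
qed

text \<open>Splits off the order of the main term. Each remaining summand still has the factor
  (\<tau> / \<theta>) ^ (K - k) with k < K, so the second factor vanishes in the limit.\<close>

lemma epsilon0_eq:
  fixes \<psi> :: "'i \<Rightarrow> 'a::euclidean_space"
  assumes r: "\<tau> > 0" "\<theta> > 0" and K: "K \<le> DIM('a)"
  shows "epsilon0 \<psi> f \<delta>\<^sub>2 \<J> \<delta>' K \<tau> \<theta> = (\<tau> / \<theta>) ^ (DIM('a) - K) *
    (if 0 < K \<and> K < DIM('a) then \<Sum>k = k_min DIM('a) K..K - 1.
       Q_bar \<psi> f \<delta>\<^sub>2 \<J> K k * (\<tau> / \<theta>) ^ (K - k) * (1 + delta'_hat \<psi> \<J> \<delta>' K k * (\<tau> / \<theta>)) ^ k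
     else 0)"
proof -
  have "(\<tau> / \<theta>) ^ (DIM('a) - k) = (\<tau> / \<theta>) ^ (DIM('a) - K) * (\<tau> / \<theta>) ^ (K - k)"
    if "k \<in> {k_min DIM('a) K..K - 1}" for k
    using that K by (auto simp: power_add[symmetric] intro!: arg_cong[where f="(^) (\<tau> / \<theta>)"])
  then show ?thesis
    by (auto simp: epsilon0_def sum_distrib_left mult_ac intro!: sum.cong)
qed

section \<open>The two-sided estimate and its asymptotic form\<close>

theorem proposition4:
  fixes nrm f\<^sub>d :: "real ^ 'n \<Rightarrow> real"
    and I :: "'i set" and \<psi> :: "'i \<Rightarrow> real ^ 'n"
    and \<delta>\<^sub>1 \<delta>\<^sub>2 :: real
    and \<J> :: "nat \<Rightarrow> 'i set set"
    and \<delta> :: "'i set \<Rightarrow> real" and \<delta>' :: "'i set \<times> 'i set \<Rightarrow> real"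
    and K :: nat
  assumes norms: "is_norm nrm" "is_norm f\<^sub>d"
    and dictionary: "finite I" "span (\<psi> ` I) = UNIV"
    and \<delta>\<^sub>1: "\<delta>\<^sub>1 > 0" "\<And>w. f\<^sub>d w \<le> \<delta>\<^sub>1 * norm w"
    and \<delta>\<^sub>2: "\<delta>\<^sub>2 > 0" "\<And>w. norm w \<le> \<delta>\<^sub>2 * nrm w"
    and \<J>: "\<And>L. L \<le> CARD('n) \<Longrightarrow> representatives I \<psi> L (\<J> L)" "\<J> 0 = {{}}"
    and \<delta>: "\<And>J. J \<subseteq> I \<Longrightarrow> 0 \<le> \<delta> J \<and> \<delta> J \<le> \<delta>\<^sub>1 * \<delta>\<^sub>2"
      "\<And>J u. J \<subseteq> I \<Longrightarrow> u \<in> (T_span \<psi> J)\<^sup>\<bottom> \<Longrightarrow> f\<^sub>d u \<le> \<delta> J * h_gauge \<psi> nrm J u"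
    and \<delta>': "\<And>L k J1 J2. L \<le> CARD('n) \<Longrightarrow> k < L \<Longrightarrow> (J1, J2) \<in> H_pairs \<psi> \<J> L k \<Longrightarrow>
        0 \<le> \<delta>' (J1, J2) \<and> \<delta>' (J1, J2) \<le> 3 * (\<delta>\<^sub>1 * \<delta>\<^sub>2)"
      "\<And>L k J1 J2 \<tau> \<theta>. L \<le> CARD('n) \<Longrightarrow> k < L \<Longrightarrow> (J1, J2) \<in> H_pairs \<psi> \<J> L k \<Longrightarrow>
        \<tau> > 0 \<Longrightarrow> \<theta> > 0 \<Longrightarrow> \<theta> \<ge> \<delta>' (J1, J2) * \<tau> \<Longrightarrow>
        measure lborel (T_thick \<psi> nrm \<tau> J1 \<inter> T_thick \<psi> nrm \<tau> J2 \<inter> level f\<^sub>d \<theta>)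
          \<le> Q_const \<psi> f\<^sub>d \<delta>\<^sub>2 (J1, J2) * \<tau> ^ (CARD('n) - k) * (\<theta> + \<delta>' (J1, J2) * \<tau>) ^ k"
    and K: "K \<le> CARD('n)"
  shows
    "(\<forall>\<tau> \<theta> (M :: 'w measure) d.
        \<tau> > 0 \<and> \<theta> \<ge> \<tau> * Delta \<psi> \<J> \<delta> \<delta>' K \<and> uniformly_distributed M d (level f\<^sub>d \<theta>) \<longrightarrow>
        C_bar \<psi> nrm f\<^sub>d \<J> K / measure lborel (level f\<^sub>d 1) * (\<tau> / \<theta>) ^ (CARD('n) - K) *
            (1 - delta_hat \<J> \<delta> K * (\<tau> / \<theta>)) ^ K
          - epsilon0 \<psi> f\<^sub>d \<delta>\<^sub>2 \<J> \<delta>' K \<tau> \<theta> / measure lborel (level f\<^sub>d 1)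
          \<le> \<P>(\<omega> in M. val I \<psi> nrm \<tau> (d \<omega>) \<le> K) \<and>
        \<P>(\<omega> in M. val I \<psi> nrm \<tau> (d \<omega>) \<le> K)
          \<le> C_bar \<psi> nrm f\<^sub>d \<J> K / measure lborel (level f\<^sub>d 1) * (\<tau> / \<theta>) ^ (CARD('n) - K) *
            (1 + delta_hat \<J> \<delta> K * (\<tau> / \<theta>)) ^ K) \<and>
     (\<forall>(M :: real \<Rightarrow> 'w measure) d.
        (\<forall>\<theta>>0. uniformly_distributed (M \<theta>) (d \<theta>) (level f\<^sub>d \<theta>)) \<longrightarrow>
        (\<lambda>(\<tau>, \<theta>). \<P>(\<omega> in M \<theta>. val I \<psi> nrm \<tau> (d \<theta> \<omega>) \<le> K)
            - C_bar \<psi> nrm f\<^sub>d \<J> K / measure lborel (level f\<^sub>d 1) * (\<tau> / \<theta>) ^ (CARD('n) - K))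
          \<in> o[ratio_to_0](\<lambda>(\<tau>, \<theta>). (\<tau> / \<theta>) ^ (CARD('n) - K)))"
proof -
  let ?N = "CARD('n)"
  let ?dh = "delta_hat \<J> \<delta> K" and ?\<Delta> = "Delta \<psi> \<J> \<delta> \<delta>' K"
  let ?L1 = "measure lborel (level f\<^sub>d 1)"
  let ?Cb = "C_bar \<psi> nrm f\<^sub>d \<J> K"
  let ?\<epsilon> = "epsilon0 \<psi> f\<^sub>d \<delta>\<^sub>2 \<J> \<delta>' K"
  have N: "DIM(real ^ 'n) = ?N" by simp
  note rep = \<J>(1)[OF K]
  have finJ: "finite (\<J> K)" by (rule finite_representatives[OF rep dictionary(1)])
  have sub: "subspace (T_span \<psi> J)" for J by (simp add: T_span_def)
  have JI: "J \<subseteq> I" "dim (T_span \<psi> J) = K" if "J \<in> \<J> K" for J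
    using rep that by (auto simp: representatives_def)
  have dJ: "\<delta> J \<le> ?dh" if "J \<in> \<J> K" for J
    unfolding delta_hat_def using finJ that by (intro Max_ge) auto
  have bounds: "?Cb / ?L1 * (\<tau> / \<theta>) ^ (?N - K) * (1 - ?dh * (\<tau> / \<theta>)) ^ K - ?\<epsilon> \<tau> \<theta> / ?L1
          \<le> \<P>(\<omega> in M. val I \<psi> nrm \<tau> (d \<omega>) \<le> K)" (is "?lower \<le> ?p")
      "\<P>(\<omega> in M. val I \<psi> nrm \<tau> (d \<omega>) \<le> K)
          \<le> ?Cb / ?L1 * (\<tau> / \<theta>) ^ (?N - K) * (1 + ?dh * (\<tau> / \<theta>)) ^ K"
    if \<tau>: "\<tau> > 0" and \<theta>\<Delta>: "\<theta> \<ge> \<tau> * ?\<Delta>" and X: "uniformly_distributed M d (level f\<^sub>d \<theta>)"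
    for \<tau> \<theta> and M :: "'w measure" and d
  proof -
    \<comment> \<open>If \<open>Delta\<close> is 0, the inequality on \<theta> still allows \<theta>
      = 0; the existence of the uniform law excludes it.\<close>
    have \<theta>: "\<theta> > 0" by (rule uniformly_distributed_level(1)[OF norms(2) X])
    have L\<theta>: "measure lborel (level f\<^sub>d \<theta>) = \<theta> ^ ?N * ?L1"
      using measure_level[OF norms(2) \<theta>] by simp
    then have L1: "?L1 > 0"
      using uniformly_distributed_level(2)[OF norms(2) X] \<theta> by (simp add: zero_less_mult_iff)
    let ?A = "\<lambda>J. T_thick \<psi> nrm \<tau> J \<inter> level f\<^sub>d \<theta>"
    have closedT: "closed (T_thick \<psi> nrm \<tau> J)" for J
      unfolding T_thick_eq_slab by (rule closed_slab[OF sub norms(1)])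
    have A: "?A J \<in> fmeasurable lborel" for J
      by (intro fmeasurable_compact closed_Int_compact closedT compact_level norms)
    have dh\<theta>: "?dh * \<tau> \<le> \<theta>"
      using \<theta>\<Delta> delta_hat_le_Delta[of \<J> \<delta> K \<psi> \<delta>'] \<tau>
      by (metis mult.commute mult_left_mono less_imp_le order_trans)
    \<comment> \<open>Passing from \<open>\<delta> J\<close> to the common maximum weakens both
      bounds but makes the second factor independent of \<open>J\<close>, so the sum gives
      \<open>C_bar\<close>. The form \<open>(- ?dh)\<close> fits
      \<open>power_ratio_factor\<close>.\<close>
    have A_bounds: "C_const \<psi> nrm f\<^sub>d J * (\<tau> ^ (?N - K) * (\<theta> + (- ?dh) * \<tau>) ^ K) \<le> measure lborel (?A J)"
      "measure lborel (?A J) \<le> C_const \<psi> nrm f\<^sub>d J * (\<tau> ^ (?N - K) * (\<theta> + ?dh * \<tau>) ^ K)"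
      if J: "J \<in> \<J> K" for J
    proof -
      have d0: "\<delta> J \<ge> 0" using \<delta>(1)[OF JI(1)[OF J]] by simp
      have fu: "f\<^sub>d u \<le> \<delta> J" if u: "u \<in> orth_proj ((T_span \<psi> J)\<^sup>\<bottom>) ` level nrm 1" for u
      proof -
        have "u \<in> (T_span \<psi> J)\<^sup>\<bottom>" using u orth_proj(1)[OF subspace_orthogonal_comp] by blast
        then have "f\<^sub>d u \<le> \<delta> J * h_gauge \<psi> nrm J u" by (rule \<delta>(2)[OF JI(1)[OF J]])
        also have "\<dots> \<le> \<delta> J * 1" using h_gauge_le_1[OF u] d0 by (rule mult_left_mono)
        finally show ?thesis by simp
      qed
      have d\<tau>: "\<delta> J * \<tau> \<le> ?dh * \<tau>" using dJ[OF J] \<tau> by (intro mult_right_mono) auto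
      then have d\<theta>: "\<theta> \<ge> \<delta> J * \<tau>" using dh\<theta> by linarith
      note slab = measure_slab_level_bounds[OF sub[of J] norms d0 fu \<tau> \<theta> d\<theta>,
          folded T_thick_eq_slab C_const_def, unfolded N JI(2)[OF J] mult.assoc]
      have "C_const \<psi> nrm f\<^sub>d J * (\<tau> ^ (?N - K) * (\<theta> + (- ?dh) * \<tau>) ^ K)
          \<le> C_const \<psi> nrm f\<^sub>d J * (\<tau> ^ (?N - K) * (\<theta> - \<delta> J * \<tau>) ^ K)"
        using d\<tau> dh\<theta> \<tau> by (intro mult_left_mono power_mono C_const_nonneg) auto
      also note slab(2)
      finally show "C_const \<psi> nrm f\<^sub>d J * (\<tau> ^ (?N - K) * (\<theta> + (- ?dh) * \<tau>) ^ K) \<le> measure lborel (?A J)" .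
      note slab(1)
      also have "C_const \<psi> nrm f\<^sub>d J * (\<tau> ^ (?N - K) * (\<theta> + \<delta> J * \<tau>) ^ K)
          \<le> C_const \<psi> nrm f\<^sub>d J * (\<tau> ^ (?N - K) * (\<theta> + ?dh * \<tau>) ^ K)"
        using d\<tau> d0 \<theta> \<tau> by (intro mult_left_mono power_mono C_const_nonneg) auto
      finally show "measure lborel (?A J) \<le> C_const \<psi> nrm f\<^sub>d J * (\<tau> ^ (?N - K) * (\<theta> + ?dh * \<tau>) ^ K)" .
    qed
    have p: "?p = measure lborel (\<Union>J\<in>\<J> K. ?A J) / (\<theta> ^ ?N * ?L1)"
    proof -
      have "?p = \<P>(\<omega> in M. d \<omega> \<in> (\<Union>J\<in>\<J> K. T_thick \<psi> nrm \<tau> J))"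
        using val_le_iff[OF dictionary norms(1) \<tau> rep] K by simp
      also have "\<dots> = measure lborel ((\<Union>J\<in>\<J> K. T_thick \<psi> nrm \<tau> J) \<inter> level f\<^sub>d \<theta>) / measure lborel (level f\<^sub>d \<theta>)"
        by (intro uniformly_distributed_level(3)[OF norms(2) X] closed_UN finJ closedT ballI)
      also have "(\<Union>J\<in>\<J> K. T_thick \<psi> nrm \<tau> J) \<inter> level f\<^sub>d \<theta> = (\<Union>J\<in>\<J> K. ?A J)" by blast
      finally show ?thesis unfolding L\<theta> .
    qed
    have rescale: "\<theta> ^ ?N * (x * y) / (\<theta> ^ ?N * ?L1) = x / ?L1 * y" for x y
      using \<theta> by simp
    have "measure lborel (\<Union>J\<in>\<J> K. ?A J) \<le> (\<Sum>J\<in>\<J> K. measure lborel (?A J))"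
      using finJ fmeasurableD[OF A] by (intro measure_UNION_le) auto
    also have "\<dots> \<le> (\<Sum>J\<in>\<J> K. C_const \<psi> nrm f\<^sub>d J * (\<tau> ^ (?N - K) * (\<theta> + ?dh * \<tau>) ^ K))"
      by (intro sum_mono A_bounds)
    also have "\<dots> = ?Cb * (\<tau> ^ (?N - K) * (\<theta> + ?dh * \<tau>) ^ K)"
      by (simp only: C_bar_def sum_distrib_right)
    also have "\<dots> = \<theta> ^ ?N * (?Cb * ((\<tau> / \<theta>) ^ (?N - K) * (1 + ?dh * (\<tau> / \<theta>)) ^ K))"
      unfolding power_ratio_factor[OF \<theta> K] by (simp only: mult_ac)
    finally have "?p \<le> \<theta> ^ ?N * (?Cb * ((\<tau> / \<theta>) ^ (?N - K) * (1 + ?dh * (\<tau> / \<theta>)) ^ K)) / (\<theta> ^ ?N * ?L1)"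
      unfolding p using \<theta> L1 by (intro divide_right_mono) auto
    then show "?p \<le> ?Cb / ?L1 * (\<tau> / \<theta>) ^ (?N - K) * (1 + ?dh * (\<tau> / \<theta>)) ^ K"
      unfolding rescale by (simp only: mult.assoc)
    have pairs: "(\<Sum>(J1, J2)\<in>{(J1, J2). J1 \<in> \<J> K \<and> J2 \<in> \<J> K \<and> J1 \<noteq> J2}. measure lborel (?A J1 \<inter> ?A J2))
        \<le> \<theta> ^ ?N * ?\<epsilon> \<tau> \<theta>"
    proof (rule measure_pairs_le_epsilon0[where ?\<J> = \<J>, OF rep finJ, unfolded N])
      fix k J1 J2 assume k: "k < K" and H: "(J1, J2) \<in> H_pairs \<psi> \<J> K k"
      show "0 \<le> \<delta>' (J1, J2)" using \<delta>'(1)[OF K k H] by simp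
      assume "\<theta> \<ge> \<delta>' (J1, J2) * \<tau>"
      moreover have "?A J1 \<inter> ?A J2 = T_thick \<psi> nrm \<tau> J1 \<inter> T_thick \<psi> nrm \<tau> J2 \<inter> level f\<^sub>d \<theta>" by blast
      ultimately show "measure lborel (?A J1 \<inter> ?A J2)
          \<le> Q_const \<psi> f\<^sub>d \<delta>\<^sub>2 (J1, J2) * \<tau> ^ (?N - k) * (\<theta> + \<delta>' (J1, J2) * \<tau>) ^ k"
        using \<delta>'(2)[OF K k H \<tau> \<theta>] by simp
    qed (use K \<tau> \<theta> \<theta>\<Delta> in simp_all)
    have "\<theta> ^ ?N * (?Cb * ((\<tau> / \<theta>) ^ (?N - K) * (1 + (- ?dh) * (\<tau> / \<theta>)) ^ K))
        = ?Cb * (\<tau> ^ (?N - K) * (\<theta> + (- ?dh) * \<tau>) ^ K)"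
      unfolding power_ratio_factor[OF \<theta> K] by (simp only: mult_ac)
    also have "\<dots> = (\<Sum>J\<in>\<J> K. C_const \<psi> nrm f\<^sub>d J * (\<tau> ^ (?N - K) * (\<theta> + (- ?dh) * \<tau>) ^ K))"
      by (simp only: C_bar_def sum_distrib_right)
    also have "\<dots> \<le> (\<Sum>J\<in>\<J> K. measure lborel (?A J))"
      by (intro sum_mono A_bounds)
    \<comment> \<open>The factor 1 gives the error term the product shape that
      \<open>rescale\<close> rewrites.\<close>
    finally have "\<theta> ^ ?N * (?Cb * ((\<tau> / \<theta>) ^ (?N - K) * (1 + (- ?dh) * (\<tau> / \<theta>)) ^ K)) - \<theta> ^ ?N * (?\<epsilon> \<tau> \<theta> * 1)
        \<le> measure lborel (\<Union>J\<in>\<J> K. ?A J)"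
      using bonferroni_lower[OF finJ, of ?A lborel, OF A] pairs by simp
    then have "(\<theta> ^ ?N * (?Cb * ((\<tau> / \<theta>) ^ (?N - K) * (1 + (- ?dh) * (\<tau> / \<theta>)) ^ K)) - \<theta> ^ ?N * (?\<epsilon> \<tau> \<theta> * 1))
        / (\<theta> ^ ?N * ?L1) \<le> ?p"
      unfolding p using \<theta> L1 by (intro divide_right_mono) auto
    then show "?lower \<le> ?p"
      unfolding diff_divide_distrib rescale by (simp add: mult.assoc)
  qed
  have asymp: "(\<lambda>(\<tau>, \<theta>). \<P>(\<omega> in M \<theta>. val I \<psi> nrm \<tau> (d \<theta> \<omega>) \<le> K) - ?Cb / ?L1 * (\<tau> / \<theta>) ^ (?N - K))
          \<in> o[ratio_to_0](\<lambda>(\<tau>, \<theta>). (\<tau> / \<theta>) ^ (?N - K))"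
    if X: "\<forall>\<theta>>0. uniformly_distributed (M \<theta>) (d \<theta>) (level f\<^sub>d \<theta>)"
    for M :: "real \<Rightarrow> 'w measure" and d
  proof -
    \<comment> \<open>The second factor of \<open>epsilon0_eq\<close> as a function of the ratio r =
      \<tau> / \<theta>.\<close>
    define g where "g r = (if 0 < K \<and> K < ?N then \<Sum>k = k_min ?N K..K - 1.
       Q_bar \<psi> f\<^sub>d \<delta>\<^sub>2 \<J> K k * r ^ (K - k) * (1 + delta'_hat \<psi> \<J> \<delta>' K k * r) ^ k else 0)" for r :: real
    let ?r = "\<lambda>(\<tau>, \<theta>). \<tau> / \<theta> :: real"
    \<comment> \<open>\<open>lo\<close> and \<open>up\<close> are the two bounds minus the main
      term, divided by r ^ (N - K). They depend on r alone, so ordinary limits at 0 suffice for the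
      filter on pairs.\<close>
    define lo where "lo r = ?Cb / ?L1 * ((1 - ?dh * r) ^ K - 1) - g r / ?L1" for r
    define up where "up r = ?Cb / ?L1 * ((1 + ?dh * r) ^ K - 1)" for r
    have "uniformly_distributed (M 1) (d 1) (level f\<^sub>d 1)" using X by simp
    then have L1: "?L1 \<noteq> 0" using uniformly_distributed_level(2)[OF norms(2)] by fastforce
    have id0: "((\<lambda>r. r) \<longlongrightarrow> 0) (nhds (0::real))" by (rule filterlim_ident)
    have "(g \<longlongrightarrow> g 0) (nhds 0)"
    proof (cases "0 < K \<and> K < ?N")
      case True
      show ?thesis unfolding g_def if_P[OF True] by (intro tendsto_intros id0)
    next
      case False
      show ?thesis unfolding g_def if_not_P[OF False] by (rule tendsto_const)
    qed
    moreover have "g 0 = 0"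
      unfolding g_def by (auto intro!: sum.neutral simp: power_0_left)
    ultimately have g0: "(g \<longlongrightarrow> 0) (nhds 0)" by simp
    have r0: "filterlim ?r (nhds 0) ratio_to_0"
      unfolding ratio_to_0_def by (rule filterlim_mono[OF filterlim_filtercomap order_refl inf_le1])
    have "(lo \<longlongrightarrow> ?Cb / ?L1 * ((1 - ?dh * 0) ^ K - 1) - 0 / ?L1) (nhds 0)"
      unfolding lo_def by (intro tendsto_intros g0 id0 L1)
    then have lo: "((\<lambda>x. lo (?r x)) \<longlongrightarrow> 0) ratio_to_0"
      using filterlim_compose[OF _ r0, of lo] by simp
    have "(up \<longlongrightarrow> ?Cb / ?L1 * ((1 + ?dh * 0) ^ K - 1)) (nhds 0)"
      unfolding up_def by (intro tendsto_intros id0 L1)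
    then have up: "((\<lambda>x. up (?r x)) \<longlongrightarrow> 0) ratio_to_0"
      using filterlim_compose[OF _ r0, of up] by simp
    have pos: "eventually (\<lambda>x. x \<in> {0<..} \<times> {0<..}) ratio_to_0"
      unfolding ratio_to_0_def eventually_inf_principal by (rule always_eventually) blast
    \<comment> \<open>Eventually r * Delta_K < 1, which is the condition \<theta> \<ge> \<tau> *
      Delta_K under which the bounds hold.\<close>
    have "((\<lambda>x. ?r x * ?\<Delta>) \<longlongrightarrow> 0 * ?\<Delta>) ratio_to_0"
      using r0 by (intro tendsto_mult tendsto_const)
    then have small: "eventually (\<lambda>x. ?r x * ?\<Delta> < 1) ratio_to_0"
      by (rule order_tendstoD) simp
    let ?p = "\<lambda>(\<tau>, \<theta>). \<P>(\<omega> in M \<theta>. val I \<psi> nrm \<tau> (d \<theta> \<omega>) \<le> K) - ?Cb / ?L1 * (\<tau> / \<theta>) ^ (?N - K)"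
    let ?q = "\<lambda>(\<tau>, \<theta>). (\<tau> / \<theta>) ^ (?N - K) :: real"
    have sandwich: "lo (?r x) \<le> ?p x / ?q x \<and> ?p x / ?q x \<le> up (?r x)"
      if x: "x \<in> {0<..} \<times> {0<..}" "?r x * ?\<Delta> < 1" for x
    proof -
      obtain \<tau> \<theta> where x_eq: "x = (\<tau>, \<theta>)" by (cases x)
      have \<tau>: "\<tau> > 0" and \<theta>: "\<theta> > 0" and "\<tau> / \<theta> * ?\<Delta> < 1" using x x_eq by auto
      then have le: "\<theta> \<ge> \<tau> * ?\<Delta>" by (simp add: field_simps)
      have X': "uniformly_distributed (M \<theta>) (d \<theta>) (level f\<^sub>d \<theta>)" using X \<theta> by blast
      define R where "R = (\<tau> / \<theta>) ^ (?N - K)"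
      have R: "R > 0" using \<tau> \<theta> by (simp add: R_def)
      have \<epsilon>: "?\<epsilon> \<tau> \<theta> = R * g (\<tau> / \<theta>)"
        using epsilon0_eq[OF \<tau> \<theta>, of K \<psi>] K unfolding R_def g_def N by blast
      note b = bounds(1,2)[OF \<tau> le X', folded R_def, unfolded \<epsilon>]
      define P where "P = \<P>(\<omega> in M \<theta>. val I \<psi> nrm \<tau> (d \<theta> \<omega>) \<le> K)"
      define c where "c = ?Cb / ?L1"
      have "lo (\<tau> / \<theta>) * R = c * R * (1 - ?dh * (\<tau> / \<theta>)) ^ K - R * g (\<tau> / \<theta>) / ?L1 - c * R"
        unfolding lo_def c_def[symmetric] by (simp add: algebra_simps)
      also have "\<dots> \<le> P - c * R" using b(1) unfolding P_def c_def by simp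
      finally have 1: "lo (\<tau> / \<theta>) * R \<le> P - c * R" .
      have "P - c * R \<le> c * R * (1 + ?dh * (\<tau> / \<theta>)) ^ K - c * R" using b(2) unfolding P_def c_def by simp
      also have "\<dots> = up (\<tau> / \<theta>) * R" unfolding up_def c_def[symmetric] by (simp add: algebra_simps)
      finally have "P - c * R \<le> up (\<tau> / \<theta>) * R" .
      with 1 have "lo (\<tau> / \<theta>) \<le> (P - c * R) / R \<and> (P - c * R) / R \<le> up (\<tau> / \<theta>)"
        using R by (simp add: pos_le_divide_eq pos_divide_le_eq)
      then show ?thesis unfolding x_eq prod.case P_def c_def R_def .
    qed
    have "((\<lambda>x. ?p x / ?q x) \<longlongrightarrow> 0) ratio_to_0"
    proof (rule tendsto_sandwich[OF _ _ lo up])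
      show "\<forall>\<^sub>F x in ratio_to_0. lo (?r x) \<le> ?p x / ?q x"
        using pos small by eventually_elim (rule sandwich[THEN conjunct1])
      show "\<forall>\<^sub>F x in ratio_to_0. ?p x / ?q x \<le> up (?r x)"
        using pos small by eventually_elim (rule sandwich[THEN conjunct2])
    qed
    then show ?thesis
      by (intro smalloI_tendsto) (use pos in \<open>auto elim!: eventually_mono\<close>)
  qed
  show ?thesis using bounds(1,2) asymp by blast
qed

end
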